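(* For every fixed integer $k\ge 5$, there exists a constant $C_k>0$ such that, for all sufficiently large $n$, \[ f_{k+1,k+2}^{(k)}(n)\le \exp\left(C_k\frac{\log_{(k-2)} n}{\log_{(k-1)} n}\right). \] In particular, for every fixed integer $k\ge5$, $f_{k+1,k+2}^{(k)}(n)=\bigl(\log_{(k-3)} n\bigr)^{o(1)}$ as $n\to\infty$.
   Context: The iterated logarithm is defined by $\log_{(0)}x=x$ and $\log_{(i+1)}x=\log(\log_{(i)}x)$ (so the subscript is the number of iterations, not a base). A $k$-graph is a $k$-uniform hypergraph, and $K_t^{(k)}$ denotes the complete $k$-graph on $t$ vertices. A $k$-graph is $K_t^{(k)}$-free if it contains no copy of $K_t^{(k)}$. For integers $k\le s<t$, the Erdős–Rogers function $f_{s,t}^{(k)}(n)$ is the largest integer $m$ such that every $n$-vertex $K_t^{(k)}$-free $k$-graph contains a set of $m$ vertices spanning no copy of $K_s^{(k)}$ (i.e. the induced subhypergraph on this set is $K_s^{(k)}$-free). Equivalently, $f_{s,t}^{(k)}(n)=\min\{\alpha_s(H): |V(H)|=n,\ H \text{ is a } K_t^{(k)}\text{-free } k\text{-graph}\}$, where $\alpha_s(H)$ is the largest size of a set $W\subseteq V(H)$ such that the induced subhypergraph $H[W]$ contains no copy of $K_s^{(k)}$. *)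

theory Defs
  imports Complex_Main "HOL-Library.Ramsey" "HOL-Library.Landau_Symbols"
begin

text \<open>The base of the logarithm is \<open>e\<close>. For fixed \<open>i\<close> and large \<open>x\<close> every iterate is
  positive, so the values of \<^const>\<open>ln\<close> on non-positive arguments play no role asymptotically.\<close>

definition iter_log :: "nat \<Rightarrow> real \<Rightarrow> real" where
  "iter_log i x = (ln ^^ i) x"

definition uniform_hypergraph :: "nat \<Rightarrow> 'a set \<Rightarrow> 'a set set \<Rightarrow> bool" where
  "uniform_hypergraph k V E \<longleftrightarrow> finite V \<and> E \<subseteq> nsets V k"

definition induced_edges :: "'a set set \<Rightarrow> 'a set \<Rightarrow> 'a set set" where
  "induced_edges E W = {e \<in> E. e \<subseteq> W}"

text \<open>A copy of the complete \<open>k\<close>-graph on \<open>t\<close> vertices is given by a \<open>t\<close>-set of vertices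
  all of whose \<open>k\<close>-subsets are edges.\<close>

definition complete_free :: "nat \<Rightarrow> nat \<Rightarrow> 'a set \<Rightarrow> 'a set set \<Rightarrow> bool" where
  "complete_free k t V E \<longleftrightarrow> \<not> (\<exists>T \<in> nsets V t. nsets T k \<subseteq> E)"

definition erdos_rogers_bound :: "'a itself \<Rightarrow> nat \<Rightarrow> nat \<Rightarrow> nat \<Rightarrow> nat \<Rightarrow> nat \<Rightarrow> bool" where
  "erdos_rogers_bound _ k s t n m \<longleftrightarrow>
     (\<forall>(V::'a set) E. uniform_hypergraph k V E \<and> card V = n \<and> complete_free k t V E \<longrightarrow>
        (\<exists>W \<subseteq> V. card W = m \<and> complete_free k s W (induced_edges E W)))"

text \<open>Taking the vertices to be natural numbers loses no generality, by
  \<open>erdos_rogers_bound_transfer\<close> below.\<close>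

definition erdos_rogers :: "nat \<Rightarrow> nat \<Rightarrow> nat \<Rightarrow> nat \<Rightarrow> nat" where
  "erdos_rogers k s t n = (GREATEST m. erdos_rogers_bound TYPE(nat) k s t n m)"

lemma erdos_rogers_bound_transfer:
  assumes "erdos_rogers_bound TYPE(nat) k s t n m"
  shows "erdos_rogers_bound TYPE('a) k s t n m"
  unfolding erdos_rogers_bound_def
proof (intro allI impI)
  fix V :: "'a set" and E
  assume H: "uniform_hypergraph k V E \<and> card V = n \<and> complete_free k t V E"
  then have "finite V" by (simp add: uniform_hypergraph_def)
  then obtain h where h: "bij_betw h V {0..<card V}"
    using ex_bij_betw_finite_nat by blast
  then have inj: "inj_on h V" and img: "h ` V = {0..<card V}" 
    by (auto simp: bij_betw_def)
  define F where "F = image h ` E"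
  have sub: "e \<subseteq> V" if "e \<in> E" for e
    using H that by (auto simp: uniform_hypergraph_def nsets_def)
  have F_iff: "h ` e \<in> F \<longleftrightarrow> e \<in> E" if "e \<subseteq> V" for e
  proof
    assume "h ` e \<in> F"
    then obtain d where d: "d \<in> E" "h ` e = h ` d" unfolding F_def by blast
    then have "e = d" using inj_on_image_eq_iff[OF inj that sub[OF d(1)]] by simp
    then show "e \<in> E" using d by simp
  qed (simp add: F_def)
  have cardh: "card (h ` X) = card X" if "X \<subseteq> V" for X
    using that inj by (meson card_image inj_on_subset)
  have ns: "nsets (h ` X) j = image h ` nsets X j" if "X \<subseteq> V" for X j
  proof (rule set_eqI, rule iffI)
    fix Y assume "Y \<in> nsets (h ` X) j"
    then have "Y \<subseteq> h ` X" "finite Y" "card Y = j" by (auto simp: nsets_def)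
    then obtain Z where Z: "Z \<subseteq> X" "Y = h ` Z" by (meson subset_imageE)
    then have "Z \<subseteq> V" using that by blast
    then have "finite Z" "card Z = j"
      using \<open>finite V\<close> cardh Z \<open>card Y = j\<close> finite_subset by auto
    then show "Y \<in> image h ` nsets X j" using Z by (auto simp: nsets_def)
  next
    fix Y assume "Y \<in> image h ` nsets X j"
    then obtain Z where Z: "Z \<subseteq> X" "Y = h ` Z" "finite Z" "card Z = j"
      by (auto simp: nsets_def)
    moreover have "card Y = j" using Z cardh that by (metis subset_trans)
    ultimately show "Y \<in> nsets (h ` X) j" by (auto simp: nsets_def)
  qed
  have clique: "nsets (h ` T) k \<subseteq> F \<longleftrightarrow> nsets T k \<subseteq> E" if "T \<subseteq> V" for T
  proof -
    have "h ` e \<in> F \<longleftrightarrow> e \<in> E" if "e \<in> nsets T k" for e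
      using F_iff that \<open>T \<subseteq> V\<close> by (auto simp: nsets_def)
    then show ?thesis unfolding ns[OF that] by blast
  qed
  have "uniform_hypergraph k (h ` V) F"
    using H unfolding uniform_hypergraph_def F_def ns[OF subset_refl] by blast
  moreover have "card (h ` V) = n" using H cardh by simp
  moreover have "complete_free k t (h ` V) F"
    unfolding complete_free_def
  proof
    assume "\<exists>T\<in>nsets (h ` V) t. nsets T k \<subseteq> F"
    then obtain T where T: "T \<in> nsets V t" "nsets (h ` T) k \<subseteq> F"
      unfolding ns[OF subset_refl] by blast
    then have "T \<subseteq> V" by (simp add: nsets_def)
    then have "nsets T k \<subseteq> E" using T(2) clique by simp
    then show False using T(1) H unfolding complete_free_def by blast
  qed
  ultimately obtain W' where W': "W' \<subseteq> h ` V" "card W' = m"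
      "complete_free k s W' (induced_edges F W')"
    using assms unfolding erdos_rogers_bound_def by blast
  then obtain W where W: "W \<subseteq> V" "W' = h ` W" by (meson subset_imageE)
  have "complete_free k s W (induced_edges E W)"
    unfolding complete_free_def
  proof
    assume "\<exists>T\<in>nsets W s. nsets T k \<subseteq> induced_edges E W"
    then obtain T where T: "T \<in> nsets W s" "nsets T k \<subseteq> E"
      unfolding induced_edges_def by blast
    then have TW: "T \<subseteq> W" by (auto simp: nsets_def)
    then have "nsets (h ` T) k \<subseteq> F" using clique[of T] T(2) W(1) by (meson subset_trans)
    moreover have "nsets (h ` T) k \<subseteq> Pow (h ` T)" by (auto simp: nsets_def)
    moreover have "h ` T \<subseteq> W'" using TW W by auto
    ultimately have "nsets (h ` T) k \<subseteq> induced_edges F W'"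
      unfolding induced_edges_def by blast
    moreover have "h ` T \<in> nsets W' s" unfolding W(2) ns[OF W(1)] using T(1) by blast
    ultimately show False using W'(3) unfolding complete_free_def by blast
  qed
  then show "\<exists>W \<subseteq> V. card W = m \<and> complete_free k s W (induced_edges E W)"
    using W W'(2) cardh[OF W(1)] by (intro exI[of _ W]) simp
qed

text \<open>The maximum in the definition is attained.\<close>

lemma erdos_rogers_greatest:
  assumes "0 < k" "k \<le> s" "s < t"
  shows "erdos_rogers_bound TYPE(nat) k s t n (erdos_rogers k s t n)"
    and "erdos_rogers_bound TYPE(nat) k s t n m \<Longrightarrow> m \<le> erdos_rogers k s t n"
proof -
  let ?P = "erdos_rogers_bound TYPE(nat) k s t n"
  have zero: "?P 0"
  proof -
    have "nsets {} s = ({} :: nat set set)" using assms by (auto simp: nsets_def)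
    then show ?thesis
      unfolding erdos_rogers_bound_def complete_free_def by (intro allI impI exI[of _ "{}"]) simp
  qed
  have bound: "y \<le> n" if y: "?P y" for y
  proof -
    have "uniform_hypergraph k {0..<n} {}" "card {0..<n} = n"
      by (auto simp: uniform_hypergraph_def)
    moreover have "complete_free k t {0..<n} {}"
      unfolding complete_free_def
    proof
      assume "\<exists>T\<in>nsets {0..<n} t. nsets T k \<subseteq> {}"
      then obtain T where "T \<in> nsets {0..<n} t" and T3: "nsets T k = {}" by blast
      then have T: "finite T" "card T = t" by (simp_all add: nsets_def)
      obtain S where "S \<subseteq> T" "card S = k" "finite S"
        using obtain_subset_with_card_n[of k T] T(2) assms(2,3) by auto
      then have "S \<in> nsets T k" by (simp add: nsets_def)
      then show False using T3 by simp
    qed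
    ultimately obtain W where "W \<subseteq> {0..<n}" "card W = y"
      using y[unfolded erdos_rogers_bound_def, rule_format, of "{0..<n}" "{}"] by blast
    then show ?thesis using card_mono[of "{0..<n}" W] by simp
  qed
  show "?P (erdos_rogers k s t n)"
    unfolding erdos_rogers_def using GreatestI_nat[of ?P 0 n] zero bound by blast
  show "?P m \<Longrightarrow> m \<le> erdos_rogers k s t n"
    unfolding erdos_rogers_def using Greatest_le_nat[of ?P m n] bound by blast
qed

end

theory Submission
  imports Defs "HOL-Library.FuncSet" "HOL-Real_Asymp.Real_Asymp"
begin

text \<open>
  Call a \<open>k\<close>-graph on \<open>n\<close> vertices a witness for \<open>s\<close> if it has no clique on \<open>k + 2\<close> vertices
  while every set of at least \<open>s\<close> vertices contains a clique on \<open>k + 1\<close> vertices; it shows that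
  the Erdos-Rogers function at \<open>n\<close> is smaller than \<open>s\<close>. The proof builds a very economical
  witness for \<open>k = 3\<close> and steps it up, one uniformity at a time.

  \<^bold>\<open>Uniformity 3.\<close> Colour the pairs below \<open>N\<close> with words of length \<open>d\<close> over three letters, and
  let \<open>a < b < c\<close> be an edge if the colours of \<open>ab\<close> and \<open>ac\<close> are far, that is, differ in more
  than \<open>5/6\<close> of their places. Of the six pairs among four words at most five disagree in any given
  place, so no four words are pairwise far; looking at the smallest vertex of a clique, there is no clique on five vertices,
  whatever the colouring. In a random colouring every set of \<open>O(10 ^ d)\<close> vertices contains a
  clique on four vertices even for \<open>log N\<close> of order \<open>d * 10 ^ d\<close>
  (\<open>exists_colouring_with_quads\<close>), so that the size of these sets is \<open>O(log N / log log N)\<close>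
  instead of the \<open>O(log N)\<close> which a bounded number of colours would give. This gain of
  \<open>log log N\<close> is what the theorem rests on. It requires the probability that a set of size \<open>t\<close>
  fails to be exponentially small in \<open>d * t\<^sup>2\<close>, the amount of randomness in the
  set. The reason is concentration of measure: any three sets of words that are not exponentially
  sparse contain three pairwise far words, one from each (\<open>far_triple\<close>). For two vertices
  \<open>a < b\<close>, look at the pairs of colours that \<open>a\<close> and \<open>b\<close> send to \<open>t\<close> later vertices. If these
  pairs are sparse, the colours are severely restricted; if they are not, then all but a sparse
  set of colours of \<open>ab\<close> itself complete a clique. Among many vertices, one of the two
  alternatives holds for enough pairs \<open>ab\<close> to make the colouring exponentially unlikely.

  \<^bold>\<open>Stepping up.\<close> A set of numbers below \<open>2 ^ N\<close> spans a subtree of the binary tree of depth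
  \<open>N\<close>, whose branchings take place at certain levels. A set is a comb if its subtree is a path
  that always continues on the same side; its branching levels are then distinct, and a comb is
  declared an edge if its levels form an edge of the given witness on levels. Cliques inside combs
  thus correspond to cliques of levels. A set of more than \<open>4 ^ (s + 1)\<close> numbers contains a comb with
  \<open>s\<close> levels, which suffices for the step from 3 to 4. From \<open>k \<ge> 5\<close> on, the loss is only polynomial:
  two kinds of balanced \<open>k\<close>-sets (with at least two elements on each side of the root), where the
  root separates a right comb from a left comb, are made edges unconditionally. They are the
  \<open>k\<close>-subsets of one pattern with \<open>3 + (k - 2)\<close> vertices, which is therefore a clique on \<open>k + 1\<close>
  vertices. No balanced set with \<open>k + 2\<close> vertices is a clique (\<open>step_up_polynomial\<close>), and a set
  that has neither the pattern nor a long comb is small (\<open>card_le_without_balanced_pattern\<close>).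

  \<^bold>\<open>Conclusion.\<close> Starting with \<open>d\<close>, uniformity \<open>k\<close> is reached with \<open>2 ^ O(10 ^ d)\<close> as the size and
  a tower of height \<open>k - 3\<close> over \<open>2 ^ (c * d * 10 ^ d)\<close> as the number of vertices
  (\<open>er_witness_tower\<close>). If \<open>L\<close> is the \<open>(k - 2)\<close>-fold logarithm of the number of vertices, then
  \<open>10 ^ d\<close> is of order \<open>L / ln L\<close> (\<open>parameter_choice\<close>).
\<close>

section \<open>Concentration of measure for words over three letters\<close>

fun hdist :: "'a list \<Rightarrow> 'a list \<Rightarrow> nat" where
  "hdist (x # xs) (y # ys) = (if x = y then 0 else 1) + hdist xs ys"
| "hdist _ _ = 0"

definition words :: "nat \<Rightarrow> nat list set" where
  "words n = {xs. set xs \<subseteq> {..<3} \<and> length xs = n}"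

definition hdist_set :: "'a list \<Rightarrow> 'a list set \<Rightarrow> nat" where
  "hdist_set x A = Inf (hdist x ` A)"

lemma finite_words [simp]: "finite (words n)"
  unfolding words_def by (rule finite_lists_length_eq) simp

lemma card_words: "card (words n) = 3 ^ n"
  unfolding words_def by (subst card_lists_length_eq) auto

lemma words_0: "words 0 = {[]}"
  by (auto simp: words_def)

lemma words_Suc: "words (Suc n) = (\<lambda>(i, x). i # x) ` ({..<3} \<times> words n)"
  by (auto simp: words_def length_Suc_conv image_iff)

lemma length_words: "x \<in> words n \<Longrightarrow> length x = n"
  by (simp add: words_def)

lemma append_words: "x \<in> words m \<Longrightarrow> y \<in> words n \<Longrightarrow> x @ y \<in> words (m + n)"
  by (auto simp: words_def)

lemma hdist_append:
  "length xs = length xs' \<Longrightarrow> hdist (xs @ ys) (xs' @ ys') = hdist xs xs' + hdist ys ys'"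
  by (induction xs xs' rule: list_induct2) auto

lemma hdist_commute: "hdist xs ys = hdist ys xs"
  by (induction xs ys rule: hdist.induct) auto

lemma hdist_self [simp]: "hdist xs xs = 0"
  by (induction xs) auto

lemma hdist_le: "hdist xs ys \<le> length xs"
  by (induction xs ys rule: hdist.induct) auto

lemma hdist_triangle:
  "length xs = length ys \<Longrightarrow> length ys = length zs \<Longrightarrow> hdist xs zs \<le> hdist xs ys + hdist ys zs"
  by (induction xs ys zs rule: list_induct3) auto

lemma hdist_set_le: "a \<in> A \<Longrightarrow> hdist_set x A \<le> hdist x a"
  unfolding hdist_set_def by (intro cInf_lower) auto

lemma hdist_set_attained:
  assumes "A \<noteq> {}"
  obtains a where "a \<in> A" "hdist_set x A = hdist x a"
proof -
  have "Inf (hdist x ` A) \<in> hdist x ` A"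
    using assms by (intro Inf_nat_def1) auto
  then show ?thesis using that unfolding hdist_set_def by auto
qed

text \<open>
  Markov's inequality turns this bound on an exponential moment of the distance to \<open>A\<close> into
  concentration of measure. The induction splits off the first letter. A word whose first letter
  is \<open>i\<close> can be compared either with the slice of \<open>A\<close> over \<open>i\<close>, or with the largest slice at
  the cost of one more disagreement. If \<open>b\<close> is the size of the slice relative to the largest
  one, this gives the factor \<open>min (1 / b) t\<close>, and \<open>1 + t - t * b\<close> is the chord of \<open>1 / b\<close> over
  the interval from \<open>1 / t\<close> to \<open>1\<close>. The remaining quadratic in the sum of the three relative
  sizes is at most \<open>9 * (1 + t)\<^sup>2 / (4 * t)\<close>.
\<close>

lemma hamming_concentration:
  fixes t :: real
  assumes t: "t \<ge> 1"
  shows "A \<subseteq> words n \<Longrightarrow> A \<noteq> {} \<Longrightarrow>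
    (\<Sum>x\<in>words n. t ^ hdist_set x A) * card A \<le> (9 * ((1 + t)^2 / (4 * t))) ^ n"
proof (induction n arbitrary: A)
  case 0
  then have "A = {[]}" by (auto simp: words_0)
  then show ?case by (simp add: words_0 hdist_set_def)
next
  case (Suc n)
  define C where "C = (9 * ((1 + t)^2 / (4 * t))) ^ n"
  have "C > 0" unfolding C_def using t by (intro zero_less_power) (auto simp: divide_simps)
  define slice where "slice i = {x. i # x \<in> A}" for i
  have slice: "slice i \<subseteq> words n" for i
    using Suc.prems(1) by (fastforce simp: slice_def words_def)
  have fin: "finite (slice i)" for i using slice finite_words finite_subset by blast
  have A_eq: "A = (\<lambda>(i, x). i # x) ` (SIGMA i:{..<3}. slice i)"
    using Suc.prems(1) by (auto simp: slice_def words_Suc image_iff)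
  have cardA: "card A = (\<Sum>i<3. card (slice i))"
    by (subst A_eq, subst card_image) (auto simp: inj_on_def fin)
  define M where "M = Max ((\<lambda>i. card (slice i)) ` {..<3})"
  have "M \<in> (\<lambda>i. card (slice i)) ` {..<3}"
    unfolding M_def by (intro Max_in) (auto simp: lessThan_empty_iff bot_nat_def)
  then obtain j where j: "j < 3" "card (slice j) = M" by auto
  have le_M: "card (slice i) \<le> M" if "i < 3" for i
    unfolding M_def using that by (intro Max_ge) auto
  have "card A > 0" using Suc.prems finite_subset[OF _ finite_words] by (auto simp: card_gt_0_iff)
  then have "M > 0"
    using le_M unfolding cardA by (metis (no_types, lifting) gr0I le_zero_eq lessThan_iff sum.neutral)
  have "slice j \<noteq> {}" using j \<open>M > 0\<close> by auto
  define s where "s i = (\<Sum>x\<in>words n. t ^ hdist_set (i # x) A)" for i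
  define b where "b i = real (card (slice i)) / M" for i
  have s_le: "s i \<le> C / M * (1 + t - t * b i)" if i: "i < 3" for i
  proof -
    have b: "0 \<le> b i" "b i \<le> 1"
      unfolding b_def using le_M[OF i] \<open>M > 0\<close> by (auto simp: divide_simps)
    have "s i \<le> (\<Sum>x\<in>words n. t * t ^ hdist_set x (slice j))"
      unfolding s_def
    proof (rule sum_mono)
      fix x
      obtain a where a: "a \<in> slice j" "hdist_set x (slice j) = hdist x a"
        using hdist_set_attained[OF \<open>slice j \<noteq> {}\<close>] by blast
      have "hdist_set (i # x) A \<le> hdist (i # x) (j # a)"
        using a by (intro hdist_set_le) (auto simp: slice_def)
      also have "\<dots> \<le> Suc (hdist_set x (slice j))" using a by simp
      finally have "t ^ hdist_set (i # x) A \<le> t ^ Suc (hdist_set x (slice j))"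
        using t by (intro power_increasing) auto
      then show "t ^ hdist_set (i # x) A \<le> t * t ^ hdist_set x (slice j)" by simp
    qed
    also have "\<dots> \<le> t * (C / M)"
    proof -
      have "(\<Sum>x\<in>words n. t ^ hdist_set x (slice j)) * M \<le> C"
        using Suc.IH[OF slice \<open>slice j \<noteq> {}\<close>] j unfolding C_def by simp
      then have "(\<Sum>x\<in>words n. t ^ hdist_set x (slice j)) \<le> C / M"
        using \<open>M > 0\<close> by (simp add: field_simps)
      then show ?thesis
        using t mult_left_mono[of "\<Sum>x\<in>words n. t ^ hdist_set x (slice j)" "C / M" t]
        by (simp add: sum_distrib_left[symmetric])
    qed
    finally have 1: "s i \<le> C / M * t" by (simp add: mult.commute)
    show ?thesis
    proof (cases "t * b i \<le> 1")
      case True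
      have "C / M * t \<le> C / M * (1 + t - t * b i)"
        using \<open>C > 0\<close> \<open>M > 0\<close> True by (intro mult_left_mono) auto
      then show ?thesis using 1 by linarith
    next
      case False
      then have bpos: "b i > 0" using b by (cases "b i = 0") auto
      then have ne: "slice i \<noteq> {}" unfolding b_def by (auto)
      have cpos: "real (card (slice i)) > 0" using ne fin by (simp add: card_gt_0_iff)
      have "s i \<le> (\<Sum>x\<in>words n. t ^ hdist_set x (slice i))"
        unfolding s_def
      proof (rule sum_mono)
        fix x
        obtain a where a: "a \<in> slice i" "hdist_set x (slice i) = hdist x a"
          using hdist_set_attained[OF ne] by blast
        have "hdist_set (i # x) A \<le> hdist (i # x) (i # a)"
          using a by (intro hdist_set_le) (auto simp: slice_def)
        then show "t ^ hdist_set (i # x) A \<le> t ^ hdist_set x (slice i)"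
          using t a by (intro power_increasing) auto
      qed
      also have "\<dots> \<le> C / card (slice i)"
        using Suc.IH[OF slice ne] cpos unfolding C_def[symmetric] by (simp add: pos_le_divide_eq)
      also have "\<dots> = C / M * (1 / b i)"
        using \<open>M > 0\<close> cpos unfolding b_def by (simp add: field_simps)
      also have "\<dots> \<le> C / M * (1 + t - t * b i)"
      proof (intro mult_left_mono)
        have "(t * b i - 1) * (b i - 1) \<le> 0"
          using False b by (intro mult_nonneg_nonpos) auto
        then show "1 / b i \<le> 1 + t - t * b i" using bpos by (simp add: field_simps)
      qed (use \<open>C > 0\<close> in auto)
      finally show ?thesis .
    qed
  qed
  have "(\<Sum>x\<in>words (Suc n). t ^ hdist_set x A) = (\<Sum>i<3. s i)"
    unfolding words_Suc s_def
    by (subst sum.reindex) (auto simp: inj_on_def sum.cartesian_product case_prod_beta)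
  also have "\<dots> \<le> (\<Sum>i<3. C / M * (1 + t - t * b i))"
    by (intro sum_mono s_le) auto
  also have "\<dots> = C / M * (3 * (1 + t) - t * (\<Sum>i<3. b i))"
    by (simp only: sum_distrib_left[symmetric] sum_subtractf) (simp add: algebra_simps)
  finally have "(\<Sum>x\<in>words (Suc n). t ^ hdist_set x A) * card A
      \<le> C / M * (3 * (1 + t) - t * (\<Sum>i<3. b i)) * card A"
    by (intro mult_right_mono) auto
  also have "\<dots> = C * ((3 * (1 + t) - t * (\<Sum>i<3. b i)) * (\<Sum>i<3. b i))"
  proof -
    have "real (card A) = M * (\<Sum>i<3. b i)"
      using \<open>M > 0\<close> unfolding cardA b_def by (simp add: sum_divide_distrib[symmetric])
    then show ?thesis using \<open>M > 0\<close> by simp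
  qed
  also have "\<dots> \<le> C * (9 * ((1 + t)^2 / (4 * t)))"
  proof (intro mult_left_mono)
    have "(3 * (1 + t) - t * S) * S \<le> 9 * ((1 + t)^2 / (4 * t))" for S :: real
    proof -
      have "0 \<le> (2 * t * S - 3 * (1 + t))^2" by simp
      then show ?thesis using t by (simp add: field_simps power2_eq_square)
    qed
    then show "(3 * (1 + t) - t * (\<Sum>i<3. b i)) * (\<Sum>i<3. b i) \<le> 9 * ((1 + t)^2 / (4 * t))" .
  qed (use \<open>C > 0\<close> in auto)
  also have "\<dots> = (9 * ((1 + t)^2 / (4 * t))) ^ Suc n" unfolding C_def by simp
  finally show ?case .
qed


text \<open>
  Density at least \<open>2 powr (- n / 1000)\<close>: the rate \<open>1 / 1000\<close> is small enough for the
  concentration at radius \<open>n / 25\<close> below.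
\<close>

definition large :: "nat \<Rightarrow> nat list set \<Rightarrow> bool" where
  "large n X \<longleftrightarrow> X \<subseteq> words n \<and> 3 ^ n * 2 powr (- real n / 1000) \<le> real (card X)"

text \<open>
  Markov's inequality for \<open>hamming_concentration\<close>: words at distance more than \<open>n / 25\<close> have
  density at most \<open>\<rho> ^ n\<close>. The base \<open>t = 13 / 12\<close> makes the gain \<open>t powr (1 / 25)\<close> exceed the
  losses \<open>(1 + t)\<^sup>2 / (4 * t) = 625 / 624\<close> and \<open>2 powr (1 / 1000)\<close>, so that \<open>\<rho> < 1\<close>.
\<close>

lemma large_neighbourhood:
  "\<exists>n0. \<forall>n\<ge>n0. \<forall>X. large n X \<longrightarrow> 3 * card {x \<in> words n. n < 25 * hdist_set x X} < 3 ^ n"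
proof -
  define t :: real where "t = 13 / 12"
  define \<alpha> where "\<alpha> = t powr (1 / 25)"
  define \<beta> :: real where "\<beta> = 2 powr (1 / 1000)"
  define \<gamma> where "\<gamma> = (1 + t)^2 / (4 * t)"
  define \<rho> where "\<rho> = \<gamma> * \<beta> / \<alpha>"
  have "t > 1" unfolding t_def by simp
  have pos: "\<alpha> > 0" "\<beta> > 0" "\<gamma> > 0" unfolding \<alpha>_def \<beta>_def \<gamma>_def t_def by (auto simp: divide_simps)
  then have "\<rho> > 0" unfolding \<rho>_def by simp
  have \<alpha>_pow: "\<alpha> ^ n = t powr (n / 25)" for n :: nat
    using \<open>\<alpha> > 0\<close> unfolding \<alpha>_def by (simp add: powr_realpow[symmetric] powr_powr)
  have \<beta>_pow: "\<beta> ^ n = 2 powr (n / 1000)" for n :: nat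
    using \<open>\<beta> > 0\<close> unfolding \<beta>_def by (simp add: powr_realpow[symmetric] powr_powr)
  have "\<rho> < 1"
  proof (rule ccontr)
    assume "\<not> \<rho> < 1"
    then have "1 \<le> \<rho> ^ 25" by (simp add: one_le_power)
    also have "\<rho> ^ 25 = \<gamma> ^ 25 * \<beta> ^ 25 / \<alpha> ^ 25"
      unfolding \<rho>_def by (simp only: power_mult_distrib power_divide)
    also have "\<alpha> ^ 25 = 13 / 12" using \<alpha>_pow[of 25] by (simp add: t_def)
    also have "\<gamma> = 625 / 624" unfolding \<gamma>_def t_def by (simp add: power2_eq_square)
    finally have "13 / 12 \<le> (625 / 624) ^ 25 * \<beta> ^ 25" by (simp add: power_divide)
    also have "\<beta> ^ 25 \<le> 1.03"
    proof -
      have "\<beta> ^ 25 = 2 powr (1 / 40)" using \<beta>_pow[of 25] by simp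
      also have "\<dots> \<le> (1.03 ^ 40) powr (1 / 40)"
        using Bernoulli_inequality[of "3 / 100 :: real" 40] by (intro powr_mono2) auto
      also have "\<dots> = 1.03" by (subst powr_realpow[symmetric], simp, subst powr_powr) simp
      finally show ?thesis .
    qed
    finally show False by (simp add: power_divide)
  qed
  obtain n0 where n0: "\<rho> ^ n0 < 1 / 3"
    using real_arch_pow_inv[OF _ \<open>\<rho> < 1\<close>, of "1 / 3"] by auto
  show ?thesis
  proof (intro exI[of _ n0] allI impI)
    fix n X assume n: "n \<ge> n0" and X: "large n X"
    define B where "B = {x \<in> words n. n < 25 * hdist_set x X}"
    have cX: "3 ^ n / \<beta> ^ n \<le> card X"
      using X unfolding large_def \<beta>_pow by (simp add: powr_minus_divide)
    moreover have "0 < 3 ^ n / \<beta> ^ n" using pos by simp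
    ultimately have "real (card X) > 0" by linarith
    then have "X \<noteq> {}" by auto
    have "\<alpha> ^ n * card B = (\<Sum>x\<in>B. \<alpha> ^ n)" by simp
    also have "\<dots> \<le> (\<Sum>x\<in>B. t ^ hdist_set x X)"
    proof (rule sum_mono)
      fix x assume "x \<in> B"
      then have "n / 25 \<le> hdist_set x X" unfolding B_def by auto
      then have "t powr (n / 25) \<le> t powr (real (hdist_set x X))"
        using \<open>t > 1\<close> by (intro powr_mono) auto
      then show "\<alpha> ^ n \<le> t ^ hdist_set x X"
        unfolding \<alpha>_pow using \<open>t > 1\<close> by (simp add: powr_realpow)
    qed
    also have "\<dots> \<le> (\<Sum>x\<in>words n. t ^ hdist_set x X)"
      using \<open>t > 1\<close> by (intro sum_mono2) (auto simp: B_def)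
    finally have "\<alpha> ^ n * card B * (3 ^ n / \<beta> ^ n)
        \<le> (\<Sum>x\<in>words n. t ^ hdist_set x X) * card X"
      using cX pos \<open>t > 1\<close> by (intro mult_mono) (auto intro!: sum_nonneg)
    also have "\<dots> \<le> (9 * \<gamma>) ^ n"
      unfolding \<gamma>_def using X \<open>X \<noteq> {}\<close> \<open>t > 1\<close>
      by (intro hamming_concentration) (auto simp: large_def)
    also have "(9 * \<gamma>) ^ n = 3 ^ n * 3 ^ n * \<gamma> ^ n"
    proof -
      have "9 * \<gamma> = 3 * 3 * \<gamma>" by simp
      then show ?thesis by (simp only: power_mult_distrib)
    qed
    finally have le: "\<alpha> ^ n * card B * (3 ^ n / \<beta> ^ n) \<le> 3 ^ n * 3 ^ n * \<gamma> ^ n" .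
    have "b \<le> x * (g * c / a)"
      if "a > 0" "c > 0" "x > 0" "a * b * (x / c) \<le> x * x * g" for a b c g x :: real
      using that by (simp add: field_simps)
    from this[OF _ _ _ le] have "real (card B) \<le> 3 ^ n * (\<gamma> ^ n * \<beta> ^ n / \<alpha> ^ n)"
      using pos by (meson zero_less_power zero_less_numeral)
    also have "\<gamma> ^ n * \<beta> ^ n / \<alpha> ^ n = \<rho> ^ n"
      unfolding \<rho>_def by (simp only: power_mult_distrib power_divide)
    also have "3 ^ n * \<rho> ^ n \<le> 3 ^ n * \<rho> ^ n0"
      using n \<open>\<rho> > 0\<close> \<open>\<rho> < 1\<close> by (intro mult_left_mono power_decreasing) auto
    also have "\<dots> < 3 ^ n * (1 / 3)" using n0 by (intro mult_strict_left_mono) auto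
    finally have "real (3 * card B) < real (3 ^ n)" by simp
    then show "3 * card {x \<in> words n. n < 25 * hdist_set x X} < 3 ^ n"
      unfolding B_def[symmetric] by (simp only: of_nat_less_iff)
  qed
qed

definition shift :: "nat \<Rightarrow> nat list \<Rightarrow> nat list" where
  "shift i = map (\<lambda>x. (x + i) mod 3)"

lemma shift_words: "x \<in> words n \<Longrightarrow> shift i x \<in> words n"
  by (auto simp: shift_def words_def)

lemma inj_on_shift: "inj_on (shift i) (words n)"
proof (rule inj_onI)
  fix x y assume x: "x \<in> words n" and y: "y \<in> words n" and eq: "shift i x = shift i y"
  have "a = b" if "a \<in> set x" "b \<in> set y" "(a + i) mod 3 = (b + i) mod 3" for a b
  proof -
    have "a < 3" "b < 3" using that x y by (auto simp: words_def)
    moreover have "a mod 3 = b mod 3"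
      using that(3) unfolding nat_mod_eq_iff by (simp add: algebra_simps)
    ultimately show ?thesis by simp
  qed
  then show "x = y" using eq unfolding shift_def by (metis (no_types, lifting) list.inj_map_strong)
qed

lemma hdist_shift:
  assumes "i < 3" "j < 3" "i \<noteq> j"
  shows "hdist (shift i x) (shift j x) = length x"
proof -
  have "(a + i) mod 3 \<noteq> (a + j) mod 3" for a
  proof -
    have "(a + i) mod 3 = (a + j) mod 3 \<longleftrightarrow> i mod 3 = j mod 3"
      unfolding nat_mod_eq_iff by (simp add: add.assoc)
    then show ?thesis using assms by simp
  qed
  then show ?thesis by (induction x) (auto simp: shift_def)
qed

text \<open>
  The words \<open>u\<close>, \<open>u + 1\<close> and \<open>u + 2\<close> (letter by letter modulo 3) disagree everywhere. For a
  uniform \<open>u\<close> each of them is uniform, hence lies within distance \<open>n / 25\<close> of a prescribed large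
  set with probability above \<open>2 / 3\<close>; so some \<open>u\<close> works for the three sets at once.
\<close>

lemma far_triple:
  "\<exists>n0. \<forall>n\<ge>n0. \<forall>X. (\<forall>i<3. large n (X i)) \<longrightarrow>
     (\<exists>x. (\<forall>i<3::nat. x i \<in> X i) \<and> (\<forall>i<3. \<forall>j<3. i \<noteq> j \<longrightarrow> 23 * n \<le> 25 * hdist (x i) (x j)))"
proof -
  obtain n0 where "\<forall>n\<ge>n0. \<forall>X. large n X \<longrightarrow> 3 * card {x \<in> words n. n < 25 * hdist_set x X} < 3 ^ n"
    using large_neighbourhood by (rule exE)
  then have n0: "3 * card {x \<in> words n. n < 25 * hdist_set x X} < 3 ^ n"
    if "n \<ge> n0" "large n X" for n X
    using that by (elim allE impE) assumption+
  show ?thesis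
  proof (intro exI[of _ n0] allI impI)
    fix n and X :: "nat \<Rightarrow> nat list set" assume n: "n \<ge> n0" and X: "\<forall>i<3. large n (X i)"
    \<comment> \<open>\<open>B i\<close> collects the words whose translate by \<open>i\<close> is not close to \<open>X i\<close>.\<close>
define B where "B i = {u \<in> words n. n < 25 * hdist_set (shift i u) (X i)}" for i
    have "3 * card (B i) < 3 ^ n" if "i < 3" for i
    proof -
      have "card (B i) = card (shift i ` B i)"
        by (intro card_image[symmetric] inj_on_subset[OF inj_on_shift]) (auto simp: B_def)
      also have "\<dots> \<le> card {x \<in> words n. n < 25 * hdist_set x (X i)}"
        by (intro card_mono) (auto simp: B_def shift_words)
      finally show ?thesis using n0[OF n] X that by fastforce
    qed
    from this[of 0] this[of 1] this[of 2]
    have "card (B 0) + card (B 1) + card (B 2) < card (words n)" by (simp add: card_words)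
    then have "card (\<Union>i<3. B i) < card (words n)"
      using card_UN_le[of "{..<3::nat}" B] by (simp add: numeral_3_eq_3 numeral_2_eq_2 lessThan_Suc)
    moreover have "finite (\<Union>i<3. B i)" by (auto simp: B_def)
    ultimately obtain u where u: "u \<in> words n" "u \<notin> (\<Union>i<3. B i)"
      using card_mono[of "\<Union>i<3. B i" "words n"] by (metis linorder_not_less subsetI)
    have "\<exists>x. x \<in> X i \<and> 25 * hdist (shift i u) x \<le> n" if "i < 3" for i
    proof -
      have "0 < 3 ^ n * 2 powr (- real n / 1000)" by simp
      also have "\<dots> \<le> real (card (X i))" using X that by (simp add: large_def)
      finally have "X i \<noteq> {}" by auto
      then obtain x where "x \<in> X i" "hdist_set (shift i u) (X i) = hdist (shift i u) x"
        by (rule hdist_set_attained)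
      moreover have "25 * hdist_set (shift i u) (X i) \<le> n"
        using u that unfolding B_def by force
      ultimately show ?thesis by metis
    qed
    then obtain x where x: "x i \<in> X i" "25 * hdist (shift i u) (x i) \<le> n" if "i < 3" for i
      by metis
    have "23 * n \<le> 25 * hdist (x i) (x j)" if ij: "i < 3" "j < 3" "i \<noteq> j" for i j
    proof -
      have len: "length (x i) = n" if "i < 3" for i
        using x(1)[OF that] X that by (auto simp: large_def words_def)
      have lu: "length (shift i u) = n" for i using u by (simp add: shift_def words_def)
      have "n = hdist (shift i u) (shift j u)" using hdist_shift[OF ij] u by (simp add: words_def)
      also have "\<dots> \<le> hdist (shift i u) (x i) + hdist (x i) (shift j u)"
        by (intro hdist_triangle) (simp_all add: len lu ij)
      also have "hdist (x i) (shift j u) \<le> hdist (x i) (x j) + hdist (x j) (shift j u)"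
        by (intro hdist_triangle) (simp_all add: len lu ij)
      finally show ?thesis
        using x(2)[OF ij(1)] x(2)[OF ij(2)] hdist_commute[of "x j" "shift j u"] by linarith
    qed
    then show "\<exists>x. (\<forall>i<3::nat. x i \<in> X i) \<and> (\<forall>i<3. \<forall>j<3. i \<noteq> j \<longrightarrow> 23 * n \<le> 25 * hdist (x i) (x j))"
      using x(1) by blast
  qed
qed

definition far :: "nat list \<Rightarrow> nat list \<Rightarrow> bool" where
  "far x y \<longleftrightarrow> 5 * length x < 6 * hdist x y"

text \<open>
  Four letters out of three cannot be distinct, so in each place at most five of the six pairs
  of words disagree.
\<close>

lemma no_four_far:
  fixes x y z w :: "nat list"
  assumes "length x = d" "length y = d" "length z = d" "length w = d"
    and "set x \<subseteq> {..<3}" "set y \<subseteq> {..<3}" "set z \<subseteq> {..<3}" "set w \<subseteq> {..<3}"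
  shows "hdist x y + hdist x z + hdist x w + hdist y z + hdist y w + hdist z w \<le> 5 * d"
  using assms
proof (induction d arbitrary: x y z w)
  case 0
  then show ?case by simp
next
  case (Suc d)
  obtain a x' b y' c z' e w' where eq: "x = a # x'" "y = b # y'" "z = c # z'" "w = e # w'"
    using Suc.prems(1-4) by (metis length_Suc_conv)
  have cons: "hdist (u # us) (v # vs) = hdist [u] [v] + hdist us vs" for u v :: nat and us vs
    by simp
  have "hdist x' y' + hdist x' z' + hdist x' w' + hdist y' z' + hdist y' w' + hdist z' w' \<le> 5 * d"
    using Suc.prems unfolding eq by (intro Suc.IH) auto
  moreover have "hdist [a] [b] + hdist [a] [c] + hdist [a] [e]
      + hdist [b] [c] + hdist [b] [e] + hdist [c] [e] \<le> 5"
  proof -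
    have "a < 3" "b < 3" "c < 3" "e < 3" using Suc.prems unfolding eq by auto
    then have "card {a, b, c, e} \<le> card {..<3::nat}" by (intro card_mono) auto
    then have "a = b \<or> a = c \<or> a = e \<or> b = c \<or> b = e \<or> c = e"
      by (auto simp: card_insert_if split: if_splits)
    moreover have "hdist [u] [v] \<le> 1" for u v :: nat by auto
    note this[of a b] this[of a c] this[of a e] this[of b c] this[of b e] this[of c e]
    ultimately show ?thesis by (elim disjE) (simp_all del: hdist.simps)
  qed
  ultimately show ?case
    unfolding eq cons[of _ x'] cons[of _ y'] cons[of _ z'] mult_Suc_right by linarith
qed

lemma not_four_far:
  assumes "x \<in> words d" "y \<in> words d" "z \<in> words d" "w \<in> words d"
  shows "\<not> (far x y \<and> far x z \<and> far x w \<and> far y z \<and> far y w \<and> far z w)"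
proof -
  have "length x = d" "length y = d" "length z = d" using assms by (auto simp: words_def)
  moreover have "hdist x y + hdist x z + hdist x w + hdist y z + hdist y w + hdist z w \<le> 5 * d"
    using assms by (intro no_four_far) (auto simp: words_def)
  ultimately show ?thesis unfolding far_def by linarith
qed

section \<open>Counting colourings of pairs\<close>

definition upairs :: "nat \<Rightarrow> (nat \<times> nat) set" where
  "upairs N = {(a, b). a < b \<and> b < N}"

abbreviation colourings :: "nat \<Rightarrow> nat \<Rightarrow> (nat \<times> nat \<Rightarrow> nat list) set" where
  "colourings N d \<equiv> upairs N \<rightarrow>\<^sub>E words d"

lemma finite_upairs [simp]: "finite (upairs N)"
  by (rule finite_subset[of _ "{..<N} \<times> {..<N}"]) (auto simp: upairs_def)

text \<open>
  A union bound with conditioning: if the values on \<open>E0\<close> are confined to at most \<open>K\<close> of the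
  \<open>card L ^ card E0\<close> possibilities once the values outside \<open>E0\<close> are known, then the family has
  density at most \<open>K / card L ^ card E0\<close>.
\<close>

lemma card_restrictions_le:
  fixes K :: real
  assumes fin: "finite E" "finite L" and "E0 \<subseteq> E" and F: "F \<subseteq> E \<rightarrow>\<^sub>E L" and "K \<ge> 0" "L \<noteq> {}"
    and fibre: "\<And>g. g \<in> F \<Longrightarrow>
      real (card {restrict f E0 |f. f \<in> F \<and> restrict f (E - E0) = restrict g (E - E0)}) \<le> K"
  shows "real (card F) \<le> K / real (card L) ^ card E0 * real (card (E \<rightarrow>\<^sub>E L))"
proof -
  define r where "r = (\<lambda>f::'a \<Rightarrow> 'b. restrict f (E - E0))"
  have finF: "finite F" using F fin by (meson finite_PiE finite_subset)
  have "card F = card (\<Union>h\<in>r ` F. {f \<in> F. r f = h})" by (rule arg_cong[where f = card]) auto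
  also have "\<dots> \<le> (\<Sum>h\<in>r ` F. card {f \<in> F. r f = h})"
    using finF by (intro card_UN_le) auto
  finally have "real (card F) \<le> (\<Sum>h\<in>r ` F. real (card {f \<in> F. r f = h}))"
    by (simp flip: of_nat_sum)
  also have "\<dots> \<le> (\<Sum>h\<in>r ` F. K)"
  proof (rule sum_mono)
    fix h assume "h \<in> r ` F"
    then obtain g where g: "g \<in> F" "h = r g" by auto
    have "inj_on (\<lambda>f. restrict f E0) {f \<in> F. r f = h}"
    proof (rule inj_onI)
      fix f f' assume f: "f \<in> {f \<in> F. r f = h}" "f' \<in> {f \<in> F. r f = h}"
        and eq: "restrict f E0 = restrict f' E0"
      show "f = f'"
      proof
        fix x
        consider "x \<in> E0" | "x \<in> E - E0" | "x \<notin> E" by blast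
        then show "f x = f' x"
        proof cases
          case 1 then show ?thesis using eq by (metis restrict_apply')
        next
          case 2
          have "r f = r f'" using f by simp
          then show ?thesis using 2 unfolding r_def by (metis restrict_apply')
        next
          case 3 then show ?thesis using f F by (metis (mono_tags, lifting) PiE_arb mem_Collect_eq subsetD)
        qed
      qed
    qed
    then have "card {f \<in> F. r f = h} = card ((\<lambda>f. restrict f E0) ` {f \<in> F. r f = h})"
      by (simp add: card_image)
    also have "(\<lambda>f. restrict f E0) ` {f \<in> F. r f = h}
        = {restrict f E0 |f. f \<in> F \<and> restrict f (E - E0) = restrict g (E - E0)}"
      unfolding g r_def by auto
    finally show "real (card {f \<in> F. r f = h}) \<le> K" using fibre[OF g(1)] by simp
  qed
  also have "\<dots> = card (r ` F) * K" by simp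
  also have "\<dots> \<le> card ((E - E0) \<rightarrow>\<^sub>E L) * K"
  proof (intro mult_right_mono of_nat_mono card_mono finite_PiE)
    show "r ` F \<subseteq> (E - E0) \<rightarrow>\<^sub>E L"
    proof
      fix h assume "h \<in> r ` F"
      then obtain f where "f \<in> E \<rightarrow>\<^sub>E L" "h = restrict f (E - E0)" using F by (auto simp: r_def)
      then show "h \<in> (E - E0) \<rightarrow>\<^sub>E L" by (auto simp: PiE_iff)
    qed
  qed (use fin \<open>K \<ge> 0\<close> in auto)
  also have "real (card ((E - E0) \<rightarrow>\<^sub>E L)) = real (card (E \<rightarrow>\<^sub>E L)) / real (card L) ^ card E0"
  proof -
    have "card L > 0" using fin \<open>L \<noteq> {}\<close> by (simp add: card_gt_0_iff)
    moreover have "card E = card (E - E0) + card E0"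
      using \<open>E0 \<subseteq> E\<close> fin by (metis card_Diff_subset card_mono finite_subset le_add_diff_inverse2)
    ultimately show ?thesis using fin \<open>L \<noteq> {}\<close> by (simp add: card_PiE power_add)
  qed
  finally show ?thesis by (simp add: mult.commute)
qed

text \<open>
  A maximal matching in the graph \<open>R\<close> leaves an independent set.
\<close>

lemma matching_or_independent:
  fixes A :: "nat set"
  assumes "finite A"
  shows "(\<exists>u v. (\<forall>i<n. u i \<in> A \<and> v i \<in> A \<and> u i < v i \<and> R (u i) (v i)) \<and>
        (\<forall>i<n. \<forall>j<n. i \<noteq> j \<longrightarrow> {u i, v i} \<inter> {u j, v j} = {})) \<or>
    (\<exists>B \<subseteq> A. card A \<le> card B + 2 * n \<and> (\<forall>a\<in>B. \<forall>b\<in>B. a < b \<longrightarrow> \<not> R a b))"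
proof (induction n)
  case 0
  then show ?case by auto
next
  case (Suc n)
  show ?case
  proof (cases "\<exists>B \<subseteq> A. card A \<le> card B + 2 * n \<and> (\<forall>a\<in>B. \<forall>b\<in>B. a < b \<longrightarrow> \<not> R a b)")
    case True
    then obtain B where "B \<subseteq> A" "card A \<le> card B + 2 * n" "\<forall>a\<in>B. \<forall>b\<in>B. a < b \<longrightarrow> \<not> R a b"
      by blast
    then show ?thesis by (intro disjI2 exI[of _ B]) simp
  next
    case False
    then obtain u v where uv: "\<forall>i<n. u i \<in> A \<and> v i \<in> A \<and> u i < v i \<and> R (u i) (v i)"
      "\<forall>i<n. \<forall>j<n. i \<noteq> j \<longrightarrow> {u i, v i} \<inter> {u j, v j} = {}"
      using Suc.IH by blast
    define U where "U = (\<Union>i<n. {u i, v i})"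
    have "card U \<le> (\<Sum>i<n. card {u i, v i})" unfolding U_def by (rule card_UN_le) simp
    also have "\<dots> \<le> (\<Sum>i<n. 2)" by (intro sum_mono) (auto simp: card_insert_if)
    finally have "card U \<le> 2 * n" by simp
    moreover have "card A \<le> card (A - U) + card U"
      using card_mono[of "(A - U) \<union> U" A] card_Un_le[of "A - U" U] assms by (fastforce simp: U_def)
    ultimately have "card A \<le> card (A - U) + 2 * n" by linarith
    then obtain a b where ab: "a \<in> A - U" "b \<in> A - U" "a < b" "R a b" using False by blast
    have "(\<forall>i<Suc n. (u(n := a)) i \<in> A \<and> (v(n := b)) i \<in> A \<and> (u(n := a)) i < (v(n := b)) i
          \<and> R ((u(n := a)) i) ((v(n := b)) i)) \<and>
        (\<forall>i<Suc n. \<forall>j<Suc n. i \<noteq> j \<longrightarrow>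
          {(u(n := a)) i, (v(n := b)) i} \<inter> {(u(n := a)) j, (v(n := b)) j} = {})"
    proof (intro conjI allI impI)
      fix i j assume ij: "i < Suc n" "j < Suc n" "i \<noteq> j"
      have out: "a \<notin> {u k, v k}" "b \<notin> {u k, v k}" if "k < n" for k using ab that by (auto simp: U_def)
      consider "i = n" "j < n" | "j = n" "i < n" | "i < n" "j < n" using ij by linarith
      then show "{(u(n := a)) i, (v(n := b)) i} \<inter> {(u(n := a)) j, (v(n := b)) j} = {}"
      proof cases
        case 1 then show ?thesis using out[of j] by auto
      next
        case 2 then show ?thesis using out[of i] by auto
      next
        case 3 then show ?thesis using uv(2) ij by simp
      qed
    qed (use uv(1) ab in \<open>auto simp: less_Suc_eq\<close>)
    then show ?thesis by blast
  qed
qed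

text \<open>
  The pairs of colours that \<open>a\<close> and \<open>b\<close> send to \<open>D\<close>, each pair being one word of twice the length.
\<close>

definition concats :: "(nat \<times> nat \<Rightarrow> nat list) \<Rightarrow> nat \<Rightarrow> nat \<Rightarrow> nat set \<Rightarrow> nat list set" where
  "concats f a b D = (\<lambda>c. f (a, c) @ f (b, c)) ` D"

text \<open>
  For \<open>a < b < c < c'\<close> this says that the four triples of these vertices are edges, if a triple
  is an edge when the two colours at its smallest vertex are far.
\<close>

definition far_quad :: "(nat \<times> nat \<Rightarrow> nat list) \<Rightarrow> nat \<Rightarrow> nat \<Rightarrow> nat \<Rightarrow> nat \<Rightarrow> bool" where
  "far_quad f a b c c' \<longleftrightarrow> far (f (a, b)) (f (a, c)) \<and> far (f (a, b)) (f (a, c')) \<and>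
     far (f (a, c)) (f (a, c')) \<and> far (f (b, c)) (f (b, c'))"

text \<open>
  If the pairs of colours sent to two groups of later vertices are large, then almost every
  colour \<open>x\<close> of the pair itself completes a far quadruple. Otherwise the words starting with an
  exceptional \<open>x\<close> form a third large set, and \<open>far_triple\<close> in dimension \<open>2 * d\<close> yields three words
  that differ pairwise in \<open>46 / 25 * d\<close> places, hence in at least \<open>21 / 25 * d > 5 / 6 * d\<close> places
  within each half.
\<close>

lemma few_colours_avoid_quads:
  "\<exists>d0. \<forall>d\<ge>d0. \<forall>X Y Z. X \<subseteq> words d \<longrightarrow> large (2 * d) Y \<longrightarrow> large (2 * d) Z \<longrightarrow>
     (\<forall>x\<in>X. \<forall>y1 y2 z1 z2. length y1 = d \<longrightarrow> length z1 = d \<longrightarrow> y1 @ y2 \<in> Y \<longrightarrow> z1 @ z2 \<in> Z \<longrightarrow>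
        \<not> (far x y1 \<and> far x z1 \<and> far y1 z1 \<and> far y2 z2)) \<longrightarrow>
     real (card X) < 3 ^ d * 2 powr (- real d / 1000)"
proof -
  obtain n0 where "\<forall>n\<ge>n0. \<forall>X. (\<forall>i<3. large n (X i)) \<longrightarrow>
     (\<exists>x. (\<forall>i<3::nat. x i \<in> X i) \<and> (\<forall>i<3. \<forall>j<3. i \<noteq> j \<longrightarrow> 23 * n \<le> 25 * hdist (x i) (x j)))"
    using far_triple by (rule exE)
  then have n0: "\<exists>x. (\<forall>i<3::nat. x i \<in> X i) \<and> (\<forall>i<3. \<forall>j<3. i \<noteq> j \<longrightarrow> 23 * n \<le> 25 * hdist (x i) (x j))"
    if "n \<ge> n0" "\<And>i. i < 3 \<Longrightarrow> large n (X i)" for n X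
    using that by blast
  show ?thesis
  proof (intro exI[of _ "Suc n0"] allI impI, rule ccontr)
    fix d X Y Z
    assume d: "d \<ge> Suc n0" and X: "X \<subseteq> words d" and Y: "large (2 * d) Y" and Z: "large (2 * d) Z"
      and avoid: "\<forall>x\<in>X. \<forall>y1 y2 z1 z2. length y1 = d \<longrightarrow> length z1 = d \<longrightarrow> y1 @ y2 \<in> Y \<longrightarrow> z1 @ z2 \<in> Z \<longrightarrow>
        \<not> (far x y1 \<and> far x z1 \<and> far y1 z1 \<and> far y2 z2)"
      and "\<not> real (card X) < 3 ^ d * 2 powr (- real d / 1000)"
    then have cX: "3 ^ d * 2 powr (- real d / 1000) \<le> real (card X)" by simp
    \<comment> \<open>Filling up with arbitrary words keeps the density, and dimension \<open>2 * d\<close> demands less of it.\<close>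
define X' where "X' = (\<lambda>(x, w). x @ w) ` (X \<times> words d)"
    have "card X' = card (X \<times> words d)"
      unfolding X'_def
    proof (intro card_image inj_onI, clarify)
      fix x w x' w' assume "x \<in> X" "x' \<in> X" "x @ w = x' @ w'"
      moreover from this X have "length x = length x'" by (metis length_words subsetD)
      ultimately show "x = x' \<and> w = w'" by simp
    qed
    then have cX': "card X' = card X * 3 ^ d" by (simp add: card_cartesian_product card_words)
    have X': "large (2 * d) X'"
      unfolding large_def
    proof
      show "X' \<subseteq> words (2 * d)"
        using X append_words[of _ d _ d] unfolding X'_def by (auto simp: mult_2)
      have "3 ^ (2 * d) * 2 powr (- real (2 * d) / 1000) \<le> 3 ^ (2 * d) * 2 powr (- real d / 1000)"
        by (intro mult_left_mono powr_mono) auto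
      also have "\<dots> = 3 ^ d * (3 ^ d * 2 powr (- real d / 1000))"
        by (simp add: power_add mult_2)
      also have "\<dots> \<le> 3 ^ d * real (card X)" using cX by (intro mult_left_mono) auto
      finally show "3 ^ (2 * d) * 2 powr (- real (2 * d) / 1000) \<le> real (card X')"
        unfolding cX' by (simp add: mult.commute)
    qed
    define S where "S = (\<lambda>i::nat. if i = 0 then X' else if i = 1 then Y else Z)"
    have "large (2 * d) (S i)" for i using X' Y Z by (simp add: S_def)
    then obtain p where p: "\<forall>i<3. p i \<in> S i"
      and far_p: "\<forall>i<3. \<forall>j<3. i \<noteq> j \<longrightarrow> 23 * (2 * d) \<le> 25 * hdist (p i) (p j)"
      using n0[of "2 * d" S] d by auto
    have "p 0 \<in> X'" "p 1 \<in> Y" "p 2 \<in> Z"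
      using p[rule_format, of 0] p[rule_format, of 1] p[rule_format, of 2] by (simp_all add: S_def)
    moreover have "x \<in> words (2 * d) \<Longrightarrow> \<exists>x1 x2. x = x1 @ x2 \<and> length x1 = d \<and> length x2 = d" for x
      by (rule exI[of _ "take d x"], rule exI[of _ "drop d x"]) (auto simp: words_def)
    ultimately obtain x w y1 y2 z1 z2 where
      x: "x \<in> X" "w \<in> words d" "p 0 = x @ w" and
      y: "p 1 = y1 @ y2" "length y1 = d" "length y2 = d" and
      z: "p 2 = z1 @ z2" "length z1 = d" "length z2 = d"
      using Y Z unfolding X'_def large_def by (smt (verit) SigmaE case_prod_conv imageE subsetD)
    have lx: "length x = d" "length w = d" using x X by (auto simp: words_def)
    have split: "5 * d < 6 * hdist s1 s1' \<and> 5 * d < 6 * hdist s2 s2'"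
      if "23 * (2 * d) \<le> 25 * hdist (s1 @ s2) (s1' @ s2')" "length s1 = d" "length s1' = d" "length s2 = d"
      for s1 s1' s2 s2' :: "nat list"
    proof -
      have "hdist (s1 @ s2) (s1' @ s2') = hdist s1 s1' + hdist s2 s2'"
        using that by (intro hdist_append) auto
      moreover have "hdist s1 s1' \<le> d" "hdist s2 s2' \<le> d" using hdist_le that by metis+
      moreover have "d > 0" using d by simp
      ultimately show ?thesis using that(1) by linarith
    qed
    have far_p': "23 * (2 * d) \<le> 25 * hdist (p 0) (p 1)" "23 * (2 * d) \<le> 25 * hdist (p 0) (p 2)"
      "23 * (2 * d) \<le> 25 * hdist (p 1) (p 2)"
      using far_p by auto
    have "far x y1 \<and> far x z1 \<and> far y1 z1 \<and> far y2 z2"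
      unfolding far_def
      using split[of x w y1 y2] split[of x w z1 z2] split[of y1 y2 z1 z2] far_p' x y z lx by simp
    then show False using avoid x(1) y z p \<open>p 1 \<in> Y\<close> \<open>p 2 \<in> Z\<close> by metis
  qed
qed


lemma card_upairs: "real (card (upairs t)) = real t * (real t - 1) / 2"
proof (induction t)
  case 0
  then show ?case by (simp add: upairs_def)
next
  case (Suc t)
  have "upairs (Suc t) = upairs t \<union> (\<lambda>a. (a, t)) ` {..<t}"
    by (auto simp: upairs_def)
  moreover have "upairs t \<inter> (\<lambda>a. (a, t)) ` {..<t} = {}" by (auto simp: upairs_def)
  moreover have "card ((\<lambda>a. (a, t)) ` {..<t}) = t" by (subst card_image) (auto simp: inj_on_def)
  ultimately have "card (upairs (Suc t)) = card (upairs t) + t" by (simp add: card_Un_disjoint)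
  then show ?case using Suc by (simp add: field_simps)
qed

text \<open>
  The first unlikely event: \<open>t\<close> disjoint pairs, each of which sends a sparse set of colour pairs
  to the same \<open>t\<close> later vertices. There are at most \<open>2 ^ (9 ^ d)\<close> choices for each of these sparse
  sets, which is negligible; once they are fixed, each of the \<open>t\<^sup>2\<close> colour pairs
  independently falls into its set with probability at most \<open>2 powr (- 2 * d / 1000)\<close>.
\<close>

lemma card_small_matching_le:
  assumes uv: "\<And>i. i < t \<Longrightarrow> u i < v i" "\<And>i j. i < t \<Longrightarrow> j < t \<Longrightarrow> v i < q j"
    "\<And>j. j < t \<Longrightarrow> q j < N" "inj_on q {..<t}"
    and disj: "\<And>i j. i < t \<Longrightarrow> j < t \<Longrightarrow> i \<noteq> j \<Longrightarrow> {u i, v i} \<inter> {u j, v j} = {}"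
  shows "real (card {f \<in> colourings N d. \<forall>i<t. \<not> large (2 * d) (concats f (u i) (v i) (q ` {..<t}))})
    \<le> 2 ^ (9 ^ d * t) * 2 powr (- (real d * real t ^ 2 / 500)) * real (card (colourings N d))"
proof -
  define small where "small = {..<t} \<rightarrow>\<^sub>E {X \<in> Pow (words (2 * d)). \<not> large (2 * d) X}"
  define F where "F Q = {f \<in> colourings N d. \<forall>i<t. \<forall>j<t. f (u i, q j) @ f (v i, q j) \<in> Q i}" for Q
  define T where "T = {..<t} \<times> {..<t}"
  define p0 p1 where "p0 = (\<lambda>(i, j). (u i, q j))" and "p1 = (\<lambda>(i, j). (v i, q j))"
  define E0 where "E0 = p0 ` T \<union> p1 ` T"
  have mem: "(u i, q j) \<in> upairs N" "(v i, q j) \<in> upairs N" if "i < t" "j < t" for i j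
    using uv(1)[OF that(1)] uv(2)[OF that] uv(3)[OF that(2)] by (auto simp: upairs_def)
  have ne: "u i \<noteq> u j" "v i \<noteq> v j" "u i \<noteq> v j" if "i < t" "j < t" "i \<noteq> j" for i j
    using disj[OF that] by auto
  have ne': "u i \<noteq> v j" if "i < t" "j < t" for i j
    using uv(1)[OF that(1)] ne[OF that] by (cases "i = j") auto
  have "inj_on p0 T" "inj_on p1 T"
    using ne uv(4) unfolding p0_def p1_def T_def by (auto simp: inj_on_def)
  moreover have "p0 ` T \<inter> p1 ` T = {}" using ne' by (auto simp: p0_def p1_def T_def)
  ultimately have "card E0 = card T + card T"
    unfolding E0_def by (simp add: card_Un_disjoint card_image T_def)
  then have cE0: "card E0 = 2 * t\<^sup>2" by (simp add: T_def power2_eq_square)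
  have E0: "E0 \<subseteq> upairs N" using mem by (auto simp: E0_def p0_def p1_def T_def)
  define \<kappa> where "\<kappa> = 3 ^ (2 * d) * 2 powr (- real (2 * d) / 1000)"
  have "\<kappa> \<ge> 0" by (simp add: \<kappa>_def)
  have F_le: "real (card (F Q)) \<le> 2 powr (- (real d * real t ^ 2 / 500)) * real (card (colourings N d))"
    if Q: "Q \<in> small" for Q
  proof -
    have Qi: "Q i \<subseteq> words (2 * d)" "real (card (Q i)) \<le> \<kappa>" if "i < t" for i
      using Q that unfolding small_def large_def \<kappa>_def by (auto dest!: PiE_mem)
    have finQ: "finite (Q i)" if "i < t" for i
      using Qi[OF that] finite_words finite_subset by blast
    have "real (card (F Q)) \<le> \<kappa> ^ t\<^sup>2 / real (card (words d)) ^ card E0 * real (card (colourings N d))"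
    proof (rule card_restrictions_le)
      show "finite (upairs N)" "finite (words d)" "E0 \<subseteq> upairs N" "F Q \<subseteq> colourings N d"
        using E0 by (auto simp: F_def)
      show "words d \<noteq> {}" using card_words[of d] by auto
      show "0 \<le> \<kappa> ^ t\<^sup>2" using \<open>\<kappa> \<ge> 0\<close> by simp
      fix g
      define R where "R = {restrict f E0 |f. f \<in> F Q \<and> restrict f (upairs N - E0) = restrict g (upairs N - E0)}"
      define \<phi> where "\<phi> h = (\<lambda>(i, j)\<in>T. h (u i, q j) @ h (v i, q j))" for h :: "nat \<times> nat \<Rightarrow> nat list"
      have R_word: "h (u i, q j) \<in> words d" "h (v i, q j) \<in> words d"
          "h (u i, q j) @ h (v i, q j) \<in> Q i" if "h \<in> R" "i < t" "j < t" for h i j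
      proof -
        obtain f where f: "f \<in> F Q" "h = restrict f E0" using \<open>h \<in> R\<close> by (auto simp: R_def)
        have "(u i, q j) \<in> E0" "(v i, q j) \<in> E0"
          using that by (auto simp: E0_def p0_def p1_def T_def image_iff)
        then show "h (u i, q j) \<in> words d" "h (v i, q j) \<in> words d" "h (u i, q j) @ h (v i, q j) \<in> Q i"
          using f mem[OF that(2,3)] that(2,3) by (auto simp: F_def PiE_mem)
      qed
      have "inj_on \<phi> R"
      proof (rule inj_onI)
        fix h h' assume h: "h \<in> R" "h' \<in> R" and eq: "\<phi> h = \<phi> h'"
        have *: "h (u i, q j) = h' (u i, q j) \<and> h (v i, q j) = h' (v i, q j)" if "i < t" "j < t" for i j
        proof -
          have "\<phi> h (i, j) = \<phi> h' (i, j)" using eq by simp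
          then have "h (u i, q j) @ h (v i, q j) = h' (u i, q j) @ h' (v i, q j)"
            using that by (simp add: \<phi>_def T_def)
          then show ?thesis
            using R_word(1)[OF h(1) that] R_word(1)[OF h(2) that] by (simp add: words_def)
        qed
        show "h = h'"
        proof
          fix e
          show "h e = h' e"
          proof (cases "e \<in> E0")
            case True
            then show ?thesis using * by (auto simp: E0_def p0_def p1_def T_def)
          next
            case False
            then show ?thesis using h by (auto simp: R_def)
          qed
        qed
      qed
      moreover have "\<phi> ` R \<subseteq> (\<Pi>\<^sub>E (i, j)\<in>T. Q i)"
        using R_word(3) unfolding \<phi>_def T_def by (auto split: if_splits)
      moreover have "finite (\<Pi>\<^sub>E (i, j)\<in>T. Q i)"
        using finQ by (intro finite_PiE) (auto simp: T_def)
      ultimately have "card R \<le> card (\<Pi>\<^sub>E (i, j)\<in>T. Q i)"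
        by (metis card_image card_mono)
      also have "\<dots> = (\<Prod>(i, j)\<in>T. card (Q i))"
        by (subst card_PiE) (auto simp: T_def case_prod_beta)
      finally have "real (card R) \<le> (\<Prod>x\<in>T. real (card (Q (fst x))))"
        by (simp add: case_prod_beta flip: of_nat_prod)
      also have "\<dots> \<le> (\<Prod>x\<in>T. \<kappa>)" using Qi(2) by (intro prod_mono) (auto simp: T_def)
      also have "\<dots> = \<kappa> ^ t\<^sup>2" by (simp add: T_def power2_eq_square)
      finally show "real (card R) \<le> \<kappa> ^ t\<^sup>2" .
    qed
    also have "\<kappa> ^ t\<^sup>2 / real (card (words d)) ^ card E0 = (2 powr (- real (2 * d) / 1000)) ^ t\<^sup>2"
      unfolding cE0 card_words \<kappa>_def by (simp add: power_mult_distrib flip: power_mult) (simp add: mult_ac)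
    also have "\<dots> = 2 powr (- (real d * real t ^ 2 / 500))"
      by (simp add: powr_realpow[symmetric] powr_powr mult_ac)
    finally show ?thesis .
  qed
  have fin_small: "finite small" unfolding small_def by (intro finite_PiE) auto
  have "{f \<in> colourings N d. \<forall>i<t. \<not> large (2 * d) (concats f (u i) (v i) (q ` {..<t}))} \<subseteq> (\<Union>Q\<in>small. F Q)"
  proof
    fix f assume "f \<in> {f \<in> colourings N d. \<forall>i<t. \<not> large (2 * d) (concats f (u i) (v i) (q ` {..<t}))}"
    then have f: "f \<in> colourings N d" and nl: "\<And>i. i < t \<Longrightarrow> \<not> large (2 * d) (concats f (u i) (v i) (q ` {..<t}))"
      by auto
    define Q where "Q = (\<lambda>i\<in>{..<t}. concats f (u i) (v i) (q ` {..<t}))"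
    have "concats f (u i) (v i) (q ` {..<t}) \<subseteq> words (2 * d)" if "i < t" for i
    proof -
      have "f (u i, q j) @ f (v i, q j) \<in> words (d + d)" if "j < t" for j
        using PiE_mem[OF f mem(1)[OF \<open>i < t\<close> that]] PiE_mem[OF f mem(2)[OF \<open>i < t\<close> that]]
        by (rule append_words)
      then show ?thesis unfolding concats_def mult_2 by blast
    qed
    then have "Q \<in> small" using nl by (auto simp: small_def Q_def)
    moreover have "f \<in> F Q" using f by (auto simp: F_def Q_def concats_def)
    ultimately show "f \<in> (\<Union>Q\<in>small. F Q)" by blast
  qed
  moreover have "finite (\<Union>Q\<in>small. F Q)"
    using fin_small by (auto simp: F_def intro!: finite_subset[OF _ finite_PiE[of "upairs N" "\<lambda>_. words d"]])
  ultimately have "card {f \<in> colourings N d. \<forall>i<t. \<not> large (2 * d) (concats f (u i) (v i) (q ` {..<t}))}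
      \<le> card (\<Union>Q\<in>small. F Q)"
    by (rule card_mono[rotated])
  also have "\<dots> \<le> (\<Sum>Q\<in>small. card (F Q))" using fin_small by (rule card_UN_le)
  finally have "real (card {f \<in> colourings N d. \<forall>i<t. \<not> large (2 * d) (concats f (u i) (v i) (q ` {..<t}))})
      \<le> (\<Sum>Q\<in>small. real (card (F Q)))"
    by (simp flip: of_nat_sum)
  also have "\<dots> \<le> (\<Sum>Q\<in>small. 2 powr (- (real d * real t ^ 2 / 500)) * real (card (colourings N d)))"
    by (intro sum_mono F_le)
  also have "\<dots> = real (card small) * (2 powr (- (real d * real t ^ 2 / 500)) * real (card (colourings N d)))"
    by simp
  also have "\<dots> \<le> 2 ^ (9 ^ d * t) * (2 powr (- (real d * real t ^ 2 / 500)) * real (card (colourings N d)))"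
  proof (rule mult_right_mono)
    have "card small = card {X \<in> Pow (words (2 * d)). \<not> large (2 * d) X} ^ t"
      unfolding small_def by (subst card_PiE) auto
    also have "\<dots> \<le> card (Pow (words (2 * d))) ^ t"
      by (intro power_mono card_mono) auto
    also have "\<dots> = 2 ^ (9 ^ d * t)"
      by (simp add: card_Pow card_words power_mult)
    finally have "real (card small) \<le> real (2 ^ (9 ^ d * t))" by (simp only: of_nat_le_iff)
    then show "real (card small) \<le> 2 ^ (9 ^ d * t)" by simp
  qed simp
  finally show ?thesis by (simp only: mult.assoc)
qed

text \<open>
  The second unlikely event: \<open>t\<close> vertices, any two of which send large sets of colour pairs to
  \<open>C\<close> and to \<open>C'\<close> without completing a far quadruple. The colours outside the \<open>t\<close> vertices
  determine for each pair of them a sparse set in which its colour must lie. The first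
  assumption is the conclusion of \<open>few_colours_avoid_quads\<close> for \<open>d\<close>.
\<close>

lemma card_forced_le:
  assumes d0: "\<And>X Y Z. X \<subseteq> words d \<Longrightarrow> large (2 * d) Y \<Longrightarrow> large (2 * d) Z \<Longrightarrow>
     (\<forall>x\<in>X. \<forall>y1 y2 z1 z2. length y1 = d \<longrightarrow> length z1 = d \<longrightarrow> y1 @ y2 \<in> Y \<longrightarrow> z1 @ z2 \<in> Z \<longrightarrow>
        \<not> (far x y1 \<and> far x z1 \<and> far y1 z1 \<and> far y2 z2)) \<Longrightarrow>
     real (card X) < 3 ^ d * 2 powr (- real d / 1000)"
    and u: "\<And>i j. i < j \<Longrightarrow> j < t \<Longrightarrow> u i < u j" "\<And>i c. i < t \<Longrightarrow> c \<in> C \<union> C' \<Longrightarrow> u i < c"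
    and C: "C \<subseteq> {..<N}" "C' \<subseteq> {..<N}"
    and t: "t > 0" "C \<union> C' \<noteq> {}"
  shows "real (card {f \<in> colourings N d. \<forall>i j. i < j \<longrightarrow> j < t \<longrightarrow>
        large (2 * d) (concats f (u i) (u j) C) \<and> large (2 * d) (concats f (u i) (u j) C') \<and>
        (\<forall>c\<in>C. \<forall>c'\<in>C'. \<not> far_quad f (u i) (u j) c c')})
    \<le> 2 powr (- (real d * (real t * (real t - 1)) / 2000)) * real (card (colourings N d))"
    (is "real (card ?F) \<le> _")
proof -
  define E0 where "E0 = (\<lambda>(i, j). (u i, u j)) ` upairs t"
  define \<kappa> where "\<kappa> = 3 ^ d * 2 powr (- real d / 1000)"
  have "\<kappa> \<ge> 0" by (simp add: \<kappa>_def)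
  have inj_u: "inj_on u {..<t}"
    using u(1) by (metis lessThan_iff linorder_inj_onI' nat_less_le order_less_irrefl)
  then have "inj_on (\<lambda>(i, j). (u i, u j)) (upairs t)"
    by (auto simp: inj_on_def upairs_def)
  then have cE0: "card E0 = card (upairs t)" unfolding E0_def by (rule card_image)
  have uN: "u i < N" if "i < t" for i
    using t(2) u(2)[OF that] C by (metis UnE all_not_in_conv lessThan_iff order_less_trans subsetD)
  have E0: "E0 \<subseteq> upairs N" using u uN by (auto simp: E0_def upairs_def)
  have out: "(u i, c) \<in> upairs N - E0" if "i < t" "c \<in> C \<union> C'" for i c
    using that u(2)[OF that] C u(2)[OF _ that(2)] by (fastforce simp: E0_def upairs_def)
  have "real (card ?F) \<le> \<kappa> ^ card E0 / real (card (words d)) ^ card E0 * real (card (colourings N d))"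
  proof (rule card_restrictions_le)
    show "finite (upairs N)" "finite (words d)" "E0 \<subseteq> upairs N" "?F \<subseteq> colourings N d"
      using E0 by auto
    show "words d \<noteq> {}" using card_words[of d] by auto
    show "0 \<le> \<kappa> ^ card E0" using \<open>\<kappa> \<ge> 0\<close> by simp
    fix g assume g: "g \<in> ?F"
    define R where "R = {restrict f E0 |f. f \<in> ?F \<and> restrict f (upairs N - E0) = restrict g (upairs N - E0)}"
    define X where "X = (\<lambda>(a, b). {x \<in> words d. \<forall>c\<in>C. \<forall>c'\<in>C'.
      \<not> (far x (g (a, c)) \<and> far x (g (a, c')) \<and> far (g (a, c)) (g (a, c')) \<and> far (g (b, c)) (g (b, c')))})"
    have gword: "g (u i, c) \<in> words d" if "i < t" "c \<in> C \<union> C'" for i c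
      using g out[OF that] by (auto simp: PiE_mem)
    have card_X: "real (card (X e)) \<le> \<kappa>" if e: "e \<in> E0" for e
    proof -
      obtain i j where ij: "i < j" "j < t" "e = (u i, u j)"
        using e by (auto simp: E0_def upairs_def)
      have "real (card (X e)) < 3 ^ d * 2 powr (- real d / 1000)"
      proof (rule d0)
        show "X e \<subseteq> words d" by (auto simp: X_def ij)
        show "large (2 * d) (concats g (u i) (u j) C)" "large (2 * d) (concats g (u i) (u j) C')"
          using g ij by auto
        have len: "length (g (u i, c)) = d" if "c \<in> C \<union> C'" for c
          using gword[of i c] that ij by (simp add: words_def)
        show "\<forall>x\<in>X e. \<forall>y1 y2 z1 z2. length y1 = d \<longrightarrow> length z1 = d \<longrightarrow>
            y1 @ y2 \<in> concats g (u i) (u j) C \<longrightarrow> z1 @ z2 \<in> concats g (u i) (u j) C' \<longrightarrow>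
            \<not> (far x y1 \<and> far x z1 \<and> far y1 z1 \<and> far y2 z2)"
        proof (intro ballI allI impI)
          fix x y1 y2 z1 z2
          assume x: "x \<in> X e" and len': "length y1 = d" "length z1 = d"
            and y: "y1 @ y2 \<in> concats g (u i) (u j) C" and z: "z1 @ z2 \<in> concats g (u i) (u j) C'"
          obtain c where c: "c \<in> C" "y1 @ y2 = g (u i, c) @ g (u j, c)" using y by (auto simp: concats_def)
          obtain c' where c': "c' \<in> C'" "z1 @ z2 = g (u i, c') @ g (u j, c')" using z by (auto simp: concats_def)
          have "y1 = g (u i, c)" "y2 = g (u j, c)" "z1 = g (u i, c')" "z2 = g (u j, c')"
            using c c' len len' by (auto simp: append_eq_append_conv)
          then show "\<not> (far x y1 \<and> far x z1 \<and> far y1 z1 \<and> far y2 z2)"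
            using x c(1) c'(1) by (auto simp: X_def ij)
        qed
      qed
      then show ?thesis by (simp add: \<kappa>_def)
    qed
    have "R \<subseteq> (\<Pi>\<^sub>E e\<in>E0. X e)"
    proof
      fix h assume "h \<in> R"
      then obtain f where f: "f \<in> ?F" "restrict f (upairs N - E0) = restrict g (upairs N - E0)"
        and h: "h = restrict f E0" by (auto simp: R_def)
      have same: "f (u i, c) = g (u i, c)" if "i < t" "c \<in> C \<union> C'" for i c
        using f(2) out[OF that] by (metis restrict_apply')
      have "f e \<in> X e" if e: "e \<in> E0" for e
      proof -
        obtain i j where ij: "i < j" "j < t" "e = (u i, u j)"
          using e by (auto simp: E0_def upairs_def)
        have "f e \<in> words d" using f(1) E0 e by (auto simp: PiE_mem)
        moreover have "\<not> far_quad f (u i) (u j) c c'" if "c \<in> C" "c' \<in> C'" for c c'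
          using f(1) ij that by blast
        ultimately show ?thesis
          using same[of i] same[of j] ij by (auto simp: X_def far_quad_def)
      qed
      then show "h \<in> (\<Pi>\<^sub>E e\<in>E0. X e)" unfolding h by auto
    qed
    moreover have finE0: "finite E0" using E0 finite_upairs finite_subset by blast
    moreover have "finite (X e)" for e by (auto simp: X_def split: prod.splits)
    ultimately have "card R \<le> card (\<Pi>\<^sub>E e\<in>E0. X e)"
      by (intro card_mono finite_PiE)
    also have "\<dots> = (\<Prod>e\<in>E0. card (X e))" using finE0 by (rule card_PiE)
    finally have "real (card R) \<le> (\<Prod>e\<in>E0. real (card (X e)))"
      by (simp flip: of_nat_prod)
    also have "\<dots> \<le> (\<Prod>e\<in>E0. \<kappa>)" using card_X by (intro prod_mono) auto
    finally show "real (card R) \<le> \<kappa> ^ card E0" by simp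
  qed
  also have "\<kappa> ^ card E0 / real (card (words d)) ^ card E0 = (2 powr (- real d / 1000)) ^ card E0"
    unfolding card_words \<kappa>_def by (simp add: power_mult_distrib)
  also have "\<dots> = 2 powr (- (real d * (real t * (real t - 1)) / 2000))"
    unfolding cE0 by (simp add: powr_realpow[symmetric] powr_powr card_upairs)
  finally show ?thesis .
qed

lemma increasing_enumeration:
  fixes W :: "nat set"
  assumes "finite W" "card W = n"
  obtains g where "g ` {..<n} = W" "\<And>i j. i < j \<Longrightarrow> j < n \<Longrightarrow> g i < g j"
proof
  have len: "length (sorted_list_of_set W) = n" using assms by simp
  show "(\<lambda>i. sorted_list_of_set W ! i) ` {..<n} = W"
    using nth_image[of n "sorted_list_of_set W"] len assms by (simp add: atLeast0LessThan)
  show "sorted_list_of_set W ! i < sorted_list_of_set W ! j" if "i < j" "j < n" for i j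
    using that len strict_sorted_list_of_set[of W] by (simp add: sorted_wrt_nth_less)
qed

lemma inj_on_increasing:
  fixes g :: "nat \<Rightarrow> nat"
  assumes "\<And>i j. i < j \<Longrightarrow> j < n \<Longrightarrow> g i < g j"
  shows "inj_on g {..<n}"
proof (rule linorder_inj_onI')
  fix i j assume "j \<in> {..<n}" "i < j"
  then show "g i \<noteq> g j" using assms[of i j] by simp
qed

text \<open>
  The number of configurations in each of the two unlikely events is at most \<open>N ^ (3 * t)\<close>, where
  \<open>log N \<le> d * t / 10000\<close>, so the exponents of order \<open>d * t\<^sup>2\<close> win and some colouring
  avoids both events everywhere. In such a colouring, cut a set of size \<open>7 * t\<close> into an initial
  part of size \<open>5 * t\<close> and two groups of size \<open>t\<close>. Avoiding the first event for either group
  costs \<open>2 * t\<close> vertices each and leaves \<open>t\<close> vertices, any two of which send large sets to both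
  groups; if there were no far quadruple, these would realise the second event.
\<close>

lemma exists_colouring_with_quads:
  "\<exists>d0. \<forall>d\<ge>d0. \<forall>t N. t = 10 ^ d \<longrightarrow> N = 2 ^ (d * t div 10000) \<longrightarrow>
    (\<exists>f\<in>colourings N d. \<forall>W\<subseteq>{..<N}. 7 * t \<le> card W \<longrightarrow>
      (\<exists>a\<in>W. \<exists>b\<in>W. \<exists>c\<in>W. \<exists>c'\<in>W. a < b \<and> b < c \<and> c < c' \<and> far_quad f a b c c'))"
proof -
  obtain d1 where "\<forall>d\<ge>d1. \<forall>X Y Z. X \<subseteq> words d \<longrightarrow> large (2 * d) Y \<longrightarrow> large (2 * d) Z \<longrightarrow>
     (\<forall>x\<in>X. \<forall>y1 y2 z1 z2. length y1 = d \<longrightarrow> length z1 = d \<longrightarrow> y1 @ y2 \<in> Y \<longrightarrow> z1 @ z2 \<in> Z \<longrightarrow>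
        \<not> (far x y1 \<and> far x z1 \<and> far y1 z1 \<and> far y2 z2)) \<longrightarrow>
     real (card X) < 3 ^ d * 2 powr (- real d / 1000)"
    using few_colours_avoid_quads by (rule exE)
  then have d1: "real (card X) < 3 ^ d * 2 powr (- real d / 1000)"
    if "d \<ge> d1" "X \<subseteq> words d" "large (2 * d) Y" "large (2 * d) Z"
      "\<forall>x\<in>X. \<forall>y1 y2 z1 z2. length y1 = d \<longrightarrow> length z1 = d \<longrightarrow> y1 @ y2 \<in> Y \<longrightarrow> z1 @ z2 \<in> Z \<longrightarrow>
        \<not> (far x y1 \<and> far x z1 \<and> far y1 z1 \<and> far y2 z2)" for d X Y Z
    using that by blast
  obtain d2 where d2: "(9 / 10) ^ d2 < (1 / 1000 :: real)"
    using real_arch_pow_inv[of "1 / 1000" "9 / 10 :: real"] by auto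
  show ?thesis
  proof (intro exI[of _ "d1 + d2 + 3"] allI impI)
    fix d t N :: nat
    assume d: "d1 + d2 + 3 \<le> d" and t_def: "t = 10 ^ d" and N_def: "N = 2 ^ (d * t div 10000)"
    have "(10::nat) ^ 3 \<le> 10 ^ d" using d by (intro power_increasing) auto
    then have t: "t \<ge> 1000" by (simp add: t_def)
    have "(9 / 10 :: real) ^ d \<le> (9 / 10) ^ d2" using d by (intro power_decreasing) auto
    then have "(9 / 10 :: real) ^ d \<le> 1 / 1000" using d2 by linarith
    then have "(9 / 10) ^ d * 10 ^ d \<le> (1 / 1000 :: real) * 10 ^ d"
      by (rule mult_right_mono) simp
    then have "9 ^ d \<le> (1 / 1000 :: real) * 10 ^ d" by (simp add: power_divide)
    also have "\<dots> \<le> 1 / 1000 * (real d * t)" using d by (auto simp: t_def)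
    finally have nine: "9 ^ d \<le> real d * t / 1000" by simp
    define P where "P = {..<t} \<rightarrow>\<^sub>E {..<N}"
    have cardP: "card P = N ^ t" and finP: "finite P"
      unfolding P_def by (simp_all add: card_PiE finite_PiE)
    \<comment> \<open>\<open>B1\<close> and \<open>B2\<close> are the two unlikely events for given vertices; \<open>S1\<close> and \<open>S2\<close> are the
   configurations of vertices to which they apply.\<close>
define B1 where "B1 u v q = {f \<in> colourings N d. \<forall>i<t. \<not> large (2 * d) (concats f (u i) (v i) (q ` {..<t}))}"
      for u v q :: "nat \<Rightarrow> nat"
    define B2 where "B2 u q q' = {f \<in> colourings N d. \<forall>i j. i < j \<longrightarrow> j < t \<longrightarrow>
        large (2 * d) (concats f (u i) (u j) (q ` {..<t})) \<and> large (2 * d) (concats f (u i) (u j) (q' ` {..<t})) \<and>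
        (\<forall>c\<in>q ` {..<t}. \<forall>c'\<in>q' ` {..<t}. \<not> far_quad f (u i) (u j) c c')}" for u q q' :: "nat \<Rightarrow> nat"
    define S1 where "S1 = {(u, v, q) \<in> P \<times> P \<times> P. (\<forall>i<t. u i < v i) \<and> (\<forall>i<t. \<forall>j<t. v i < q j) \<and>
        inj_on q {..<t} \<and> (\<forall>i<t. \<forall>j<t. i \<noteq> j \<longrightarrow> {u i, v i} \<inter> {u j, v j} = {})}"
    define S2 where "S2 = {(u, q, q') \<in> P \<times> P \<times> P. (\<forall>i j. i < j \<longrightarrow> j < t \<longrightarrow> u i < u j) \<and>
        (\<forall>i<t. \<forall>j<t. u i < q j \<and> u i < q' j)}"
    define Bad where "Bad = (\<Union>(u, v, q)\<in>S1. B1 u v q) \<union> (\<Union>(u, q, q')\<in>S2. B2 u q q')"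
    define total where "total = real (card (colourings N d))"
    have fin_col: "finite (colourings N d)" by (intro finite_PiE) auto
    have "words d \<noteq> {}" using card_words[of d] by auto
    then have "total > 0" unfolding total_def using fin_col by (simp add: card_gt_0_iff PiE_eq_empty_iff)
    define e where "e = d * t div 10000"
    have e: "real e \<le> real d * t / 10000"
    proof -
      have "e * 10000 \<le> d * t" unfolding e_def by (rule div_times_less_eq_dividend)
      then have "real (e * 10000) \<le> real (d * t)" by (simp only: of_nat_le_iff)
      then show ?thesis by simp
    qed
    have card_S: "real (card S) \<le> 2 powr (3 * t * real e)" if "S \<subseteq> P \<times> P \<times> P" for S
    proof -
      have "card S \<le> card (P \<times> P \<times> P)" using that finP by (intro card_mono) auto
      also have "\<dots> = N ^ (3 * t)" by (simp add: card_cartesian_product cardP numeral_3_eq_3 power_add)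
      also have "\<dots> = 2 ^ (3 * t * e)" unfolding N_def e_def by (simp flip: power_mult add: mult_ac)
      finally have "real (card S) \<le> real (2 ^ (3 * t * e))" by (simp only: of_nat_le_iff)
      then show ?thesis by (simp add: powr_realpow[symmetric])
    qed
    have dt: "real d * t * t \<ge> 1000000"
    proof -
      have "1 * 1000 * 1000 \<le> real d * t * t" using t d by (intro mult_mono) auto
      then show ?thesis by simp
    qed
    \<comment> \<open>The number of configurations contributes at most \<open>3 / 10000\<close> to the coefficient of \<open>d * t\<^sup>2\<close> in the
   exponent, against \<open>1 / 500\<close> and \<open>1 / 2000\<close> from the two events.\<close>
have te: "3 * t * real e \<le> 3 * (real d * t * t) / 10000"
      using mult_left_mono[OF e, of "3 * t"] by simp
    have card_B1: "real (card (B1 u v q)) \<le> 2 powr (9 ^ d * t - real d * t * t / 500) * total"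
      if "(u, v, q) \<in> S1" for u v q
    proof -
      have "q j < N" if "j < t" for j using \<open>(u, v, q) \<in> S1\<close> that by (auto simp: S1_def P_def PiE_mem)
      then have "real (card (B1 u v q)) \<le> 2 ^ (9 ^ d * t) * 2 powr (- (real d * real t ^ 2 / 500)) * total"
        unfolding B1_def total_def using that by (intro card_small_matching_le) (auto simp: S1_def)
      also have "2 ^ (9 ^ d * t) * 2 powr (- (real d * real t ^ 2 / 500)) = 2 powr (9 ^ d * t - real d * t * t / 500)"
      proof -
        have "(2::real) ^ (9 ^ d * t) = 2 powr (9 ^ d * t)"
          using powr_realpow[of 2 "9 ^ d * t"] by simp
        then show ?thesis by (simp add: power2_eq_square mult.assoc flip: powr_add)
      qed
      finally show ?thesis .
    qed
    have card_B2: "real (card (B2 u q q')) \<le> 2 powr (- (real d * (real t * (real t - 1)) / 2000)) * total"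
      if "(u, q, q') \<in> S2" for u q q'
      unfolding B2_def total_def
    proof (rule card_forced_le)
      show "u i < u j" if "i < j" "j < t" for i j
        using \<open>(u, q, q') \<in> S2\<close> that by (auto simp: S2_def)
      show "u i < c" if "i < t" "c \<in> q ` {..<t} \<union> q' ` {..<t}" for i c
        using \<open>(u, q, q') \<in> S2\<close> that by (auto simp: S2_def)
      show "q ` {..<t} \<subseteq> {..<N}" "q' ` {..<t} \<subseteq> {..<N}"
        using that by (auto simp: S2_def P_def PiE_mem)
      show "t > 0" using t by simp
      then show "q ` {..<t} \<union> q' ` {..<t} \<noteq> {}" by auto
      show "real (card X) < 3 ^ d * 2 powr (- real d / 1000)"
        if "X \<subseteq> words d" "large (2 * d) Y" "large (2 * d) Z"
      "\<forall>x\<in>X. \<forall>y1 y2 z1 z2. length y1 = d \<longrightarrow> length z1 = d \<longrightarrow> y1 @ y2 \<in> Y \<longrightarrow> z1 @ z2 \<in> Z \<longrightarrow>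
        \<not> (far x y1 \<and> far x z1 \<and> far y1 z1 \<and> far y2 z2)" for X Y Z
        using d1[OF _ that] d by simp
    qed
    have S: "S1 \<subseteq> P \<times> P \<times> P" "S2 \<subseteq> P \<times> P \<times> P" by (auto simp: S1_def S2_def)
    then have finS: "finite S1" "finite S2" using finP by (meson finite_SigmaI finite_subset)+
    have "card Bad \<le> card (\<Union>(u, v, q)\<in>S1. B1 u v q) + card (\<Union>(u, q, q')\<in>S2. B2 u q q')"
      unfolding Bad_def by (rule card_Un_le)
    also have "\<dots> \<le> (\<Sum>(u, v, q)\<in>S1. card (B1 u v q)) + (\<Sum>(u, q, q')\<in>S2. card (B2 u q q'))"
      using card_UN_le[OF finS(1), of "\<lambda>(u, v, q). B1 u v q"] card_UN_le[OF finS(2), of "\<lambda>(u, v, q). B2 u v q"]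
      by (simp add: case_prod_unfold)
    finally have "real (card Bad) \<le> real ((\<Sum>(u, v, q)\<in>S1. card (B1 u v q)) + (\<Sum>(u, q, q')\<in>S2. card (B2 u q q')))"
      by (simp only: of_nat_le_iff)
    also have "\<dots> = (\<Sum>(u, v, q)\<in>S1. real (card (B1 u v q))) + (\<Sum>(u, q, q')\<in>S2. real (card (B2 u q q')))"
      by (simp add: case_prod_unfold)
    also have "\<dots> \<le> (\<Sum>(u, v, q)\<in>S1. 2 powr (9 ^ d * t - real d * t * t / 500) * total)
        + (\<Sum>(u, q, q')\<in>S2. 2 powr (- (real d * (real t * (real t - 1)) / 2000)) * total)"
      using card_B1 card_B2 by (intro add_mono sum_mono) auto
    also have "\<dots> = real (card S1) * (2 powr (9 ^ d * t - real d * t * t / 500) * total)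
        + real (card S2) * (2 powr (- (real d * (real t * (real t - 1)) / 2000)) * total)"
      by (simp add: case_prod_unfold)
    also have "\<dots> \<le> 2 powr (3 * t * real e) * (2 powr (9 ^ d * t - real d * t * t / 500) * total)
        + 2 powr (3 * t * real e) * (2 powr (- (real d * (real t * (real t - 1)) / 2000)) * total)"
      using card_S S \<open>total > 0\<close> by (intro add_mono mult_right_mono) auto
    also have "\<dots> = (2 powr (3 * t * real e + (9 ^ d * t - real d * t * t / 500))
        + 2 powr (3 * t * real e - real d * (real t * (real t - 1)) / 2000)) * total"
      unfolding powr_add powr_diff powr_minus by (simp add: algebra_simps divide_simps)
    also have "\<dots> \<le> (2 powr (-2) + 2 powr (-2)) * total"
    proof (intro mult_right_mono add_mono powr_mono)
      have "9 ^ d * real t \<le> real d * t / 1000 * t" using nine by (intro mult_right_mono) auto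
      then show "3 * t * real e + (9 ^ d * t - real d * t * t / 500) \<le> -2"
        using te dt by (simp add: algebra_simps)
      have "real d * t * 1000 \<le> real d * t * t" using t by (intro mult_left_mono) auto
      then show "3 * t * real e - real d * (real t * (real t - 1)) / 2000 \<le> -2"
        using te dt by (simp add: algebra_simps)
    qed (use \<open>total > 0\<close> in auto)
    also have "\<dots> < total" using \<open>total > 0\<close> by (simp add: powr_minus)
    finally have "real (card Bad) < real (card (colourings N d))" unfolding total_def .
    then have "card Bad < card (colourings N d)" by (simp only: of_nat_less_iff)
    moreover have "finite Bad" using fin_col finite_subset[of Bad "colourings N d"]
      by (auto simp: Bad_def B1_def B2_def)
    ultimately obtain f where f: "f \<in> colourings N d" "f \<notin> Bad"
      using card_mono[of Bad "colourings N d"] by (metis linorder_not_less subsetI)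
    show "\<exists>f\<in>colourings N d. \<forall>W\<subseteq>{..<N}. 7 * t \<le> card W \<longrightarrow>
      (\<exists>a\<in>W. \<exists>b\<in>W. \<exists>c\<in>W. \<exists>c'\<in>W. a < b \<and> b < c \<and> c < c' \<and> far_quad f a b c c')"
    proof (intro bexI[of _ f] allI impI f, rule ccontr)
      fix W assume W: "W \<subseteq> {..<N}" "7 * t \<le> card W"
        and no: "\<not> (\<exists>a\<in>W. \<exists>b\<in>W. \<exists>c\<in>W. \<exists>c'\<in>W. a < b \<and> b < c \<and> c < c' \<and> far_quad f a b c c')"
      obtain W' where W': "W' \<subseteq> W" "card W' = 7 * t" "finite W'"
        using obtain_subset_with_card_n[OF W(2)] by metis
      obtain g where g: "g ` {..<7 * t} = W'" "\<And>i j. i < j \<Longrightarrow> j < 7 * t \<Longrightarrow> g i < g j"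
        using increasing_enumeration[OF W'(3,2)] by metis
      have gW: "g i \<in> W" if "i < 7 * t" for i using g(1) W'(1) that by auto
      then have gN: "g i < N" if "i < 7 * t" for i using W(1) that by auto
      \<comment> \<open>The initial part and the two groups of later vertices.\<close>
define A where "A = g ` {..<5 * t}"
      define q where "q = (\<lambda>j\<in>{..<t}. g (5 * t + j))"
      define q' where "q' = (\<lambda>j\<in>{..<t}. g (6 * t + j))"
      have "inj_on g {..<5 * t}" using g(2) by (intro inj_on_increasing) simp
      then have cardA: "card A = 5 * t" by (simp add: A_def card_image)
      have A: "a \<in> W" "a < N" if "a \<in> A" for a using that gW gN by (auto simp: A_def)
      have Aq: "a < q j" "a < q' j" if "a \<in> A" "j < t" for a j
        using that g(2) by (auto simp: A_def q_def q'_def)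
      have qW: "q j \<in> W" "q' j \<in> W" "q j < N" "q' j < N" if "j < t" for j
        using that gW gN by (auto simp: q_def q'_def)
      have qq': "q i < q' j" if "i < t" "j < t" for i j using that g(2) by (auto simp: q_def q'_def)
      have qP: "q \<in> P" "q' \<in> P" using qW by (auto simp: P_def q_def q'_def)
      have "inj_on q {..<t}" "inj_on q' {..<t}"
        using g(2) by (auto intro!: inj_on_increasing simp: q_def q'_def)
      have no_match: False if r: "r \<in> {q, q'}" and uv: "\<And>i. i < t \<Longrightarrow> u i \<in> A \<and> v i \<in> A \<and> u i < v i
            \<and> \<not> large (2 * d) (concats f (u i) (v i) (r ` {..<t}))"
          "\<forall>i<t. \<forall>j<t. i \<noteq> j \<longrightarrow> {u i, v i} \<inter> {u j, v j} = {}" for r u v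
      proof -
        have "restrict u {..<t} \<in> P" "restrict v {..<t} \<in> P" "r \<in> P"
          using uv A qP r by (auto simp: P_def)
        then have "(restrict u {..<t}, restrict v {..<t}, r) \<in> S1"
          using uv Aq r \<open>inj_on q {..<t}\<close> \<open>inj_on q' {..<t}\<close> by (auto simp: S1_def)
        moreover have "f \<in> B1 (restrict u {..<t}) (restrict v {..<t}) r"
          using f(1) uv by (auto simp: B1_def)
        ultimately show False using f(2) by (auto simp: Bad_def)
      qed
      have indep: "\<exists>B\<subseteq>A'. card A' \<le> card B + 2 * t \<and>
          (\<forall>a\<in>B. \<forall>b\<in>B. a < b \<longrightarrow> large (2 * d) (concats f a b (r ` {..<t})))"
        if r: "r \<in> {q, q'}" and A': "A' \<subseteq> A" for A' r
      proof -
        have "finite A'" using A' finite_subset by (auto simp: A_def)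
        note matching_or_independent[OF this, of t "\<lambda>a b. \<not> large (2 * d) (concats f a b (r ` {..<t}))"]
        then show ?thesis
        proof (elim disjE)
          assume "\<exists>u v. (\<forall>i<t. u i \<in> A' \<and> v i \<in> A' \<and> u i < v i
              \<and> \<not> large (2 * d) (concats f (u i) (v i) (r ` {..<t})))
            \<and> (\<forall>i<t. \<forall>j<t. i \<noteq> j \<longrightarrow> {u i, v i} \<inter> {u j, v j} = {})"
          then obtain u v where uv: "\<forall>i<t. u i \<in> A' \<and> v i \<in> A' \<and> u i < v i
              \<and> \<not> large (2 * d) (concats f (u i) (v i) (r ` {..<t}))"
            "\<forall>i<t. \<forall>j<t. i \<noteq> j \<longrightarrow> {u i, v i} \<inter> {u j, v j} = {}"
            by (elim exE conjE)
          have False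
          proof (rule no_match[OF r _ uv(2)])
            fix i assume "i < t"
            then show "u i \<in> A \<and> v i \<in> A \<and> u i < v i
              \<and> \<not> large (2 * d) (concats f (u i) (v i) (r ` {..<t}))"
              using uv(1) A' by blast
          qed
          then show ?thesis ..
        qed simp
      qed
      obtain A1 where A1: "A1 \<subseteq> A" "card A \<le> card A1 + 2 * t"
          "\<forall>a\<in>A1. \<forall>b\<in>A1. a < b \<longrightarrow> large (2 * d) (concats f a b (q ` {..<t}))"
        using indep[of q A] by auto
      obtain A2 where A2: "A2 \<subseteq> A1" "card A1 \<le> card A2 + 2 * t"
          "\<forall>a\<in>A2. \<forall>b\<in>A2. a < b \<longrightarrow> large (2 * d) (concats f a b (q' ` {..<t}))"
        using indep[of q' A1] A1(1) by auto
      have "t \<le> card A2" using A1(2) A2(2) cardA by linarith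
      then obtain A3 where A3: "A3 \<subseteq> A2" "card A3 = t" "finite A3"
        using obtain_subset_with_card_n by metis
      obtain u where u: "u ` {..<t} = A3" "\<And>i j. i < j \<Longrightarrow> j < t \<Longrightarrow> u i < u j"
        using increasing_enumeration[OF A3(3,2)] by metis
      have uA: "u i \<in> A2" "u i \<in> A1" "u i \<in> A" if "i < t" for i
        using that u(1) A3(1) A2(1) A1(1) by blast+
      have "(restrict u {..<t}, q, q') \<in> S2"
        using qP uA(3) A u(2) Aq by (auto simp: S2_def P_def)
      moreover have "f \<in> B2 (restrict u {..<t}) q q'"
        unfolding B2_def
      proof (intro CollectI conjI f(1) allI impI ballI)
        fix i j assume ij: "i < j" "j < t"
        show "large (2 * d) (concats f (restrict u {..<t} i) (restrict u {..<t} j) (q ` {..<t}))"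
          "large (2 * d) (concats f (restrict u {..<t} i) (restrict u {..<t} j) (q' ` {..<t}))"
          using ij A1(3) A2(3) uA u(2)[OF ij] by auto
        fix c c' assume "c \<in> q ` {..<t}" "c' \<in> q' ` {..<t}"
        then obtain k k' where k: "k < t" "k' < t" "c = q k" "c' = q' k'" by auto
        have "i < t" using ij by simp
        have "u i < u j" "u j < c" "c < c'"
          using u(2)[OF ij] Aq(1)[OF uA(3)[OF ij(2)] k(1)] qq'[OF k(1,2)] k by auto
        moreover have "u i \<in> W" "u j \<in> W" "c \<in> W" "c' \<in> W"
          using A(1) uA(3) ij \<open>i < t\<close> qW k by auto
        ultimately have "\<not> far_quad f (u i) (u j) c c'" using no by blast
        then show "\<not> far_quad f (restrict u {..<t} i) (restrict u {..<t} j) c c'"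
          using ij by simp
      qed
      ultimately show False using f(2) by (auto simp: Bad_def)
    qed
  qed
qed

section \<open>Combs in the binary tree of levels\<close>

text \<open>
  The height of the lowest common ancestor of two leaves \<open>u\<close> and \<open>v\<close> of the infinite binary tree
  whose leaves are the natural numbers.
\<close>

definition level :: "nat \<Rightarrow> nat \<Rightarrow> nat" where
  "level u v = (LEAST j. u div 2 ^ j = v div 2 ^ j)"

lemma level_le_iff: "level u v \<le> j \<longleftrightarrow> u div 2 ^ j = v div 2 ^ j"
proof
  have "u div 2 ^ (u + v) = v div 2 ^ (u + v)"
  proof -
    have "u < 2 ^ (u + v)" "v < 2 ^ (u + v)" using less_exp[of "u + v"] by linarith+
    then show ?thesis by simp
  qed
  then have eq: "u div 2 ^ level u v = v div 2 ^ level u v"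
    unfolding level_def by (rule LeastI)
  assume "level u v \<le> j"
  then have "x div 2 ^ j = x div 2 ^ level u v div 2 ^ (j - level u v)" for x :: nat
    by (simp add: div_mult2_eq[symmetric] power_add[symmetric])
  then show "u div 2 ^ j = v div 2 ^ j" using eq by metis
next
  assume "u div 2 ^ j = v div 2 ^ j"
  then show "level u v \<le> j" unfolding level_def by (rule Least_le)
qed

lemma level_commute: "level u v = level v u"
  unfolding level_def by (simp add: eq_commute)

lemma level_self [simp]: "level u u = 0"
  using level_le_iff[of u u 0] by simp

lemma level_pos: "u \<noteq> v \<Longrightarrow> 0 < level u v"
  using level_le_iff[of u v 0] by auto

lemma level_le: "u < 2 ^ N \<Longrightarrow> v < 2 ^ N \<Longrightarrow> level u v \<le> N"
  unfolding level_le_iff by simp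

lemma level_max:
  assumes "u \<le> v" "v \<le> w"
  shows "level u w = max (level u v) (level v w)"
proof -
  have "level u w \<le> j \<longleftrightarrow> max (level u v) (level v w) \<le> j" for j
  proof -
    have "u div 2 ^ j \<le> v div 2 ^ j" "v div 2 ^ j \<le> w div 2 ^ j"
      using assms by (auto intro: div_le_mono)
    then show ?thesis by (auto simp: level_le_iff)
  qed
  then show ?thesis by (meson nle_le order_refl)
qed

text \<open>
  The two lower branches at a node cannot both branch at that node again: three leaves meeting
  pairwise at height \<open>j + 1\<close> would have three distinct ancestors at height \<open>j\<close> with a common parent.
\<close>

lemma level_neq:
  assumes "u < v" "v < w"
  shows "level u v \<noteq> level v w"
proof
  assume eq: "level u v = level v w"
  have "level u v > 0" using assms by (intro level_pos) simp
  then obtain j where j: "level u v = Suc j" by (cases "level u v") auto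
  have "u div 2 ^ j \<noteq> v div 2 ^ j" "v div 2 ^ j \<noteq> w div 2 ^ j"
    using j eq level_le_iff[of u v j] level_le_iff[of v w j] by auto
  moreover have "u div 2 ^ j \<le> v div 2 ^ j" "v div 2 ^ j \<le> w div 2 ^ j"
    using assms by (auto intro: div_le_mono)
  ultimately have "u div 2 ^ j + 2 \<le> w div 2 ^ j" by linarith
  then have "u div 2 ^ j div 2 \<noteq> w div 2 ^ j div 2" by linarith
  moreover have "u div 2 ^ Suc j = w div 2 ^ Suc j"
    using level_le_iff[of u v "Suc j"] level_le_iff[of v w "Suc j"] j eq by simp
  ultimately show False by (simp add: div_mult2_eq power_Suc2 del: power_Suc)
qed

text \<open>
  In a right comb the branchings sink from left to right: its subtree is a path that always
  continues to the right, with a single leaf on the left at each branching.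
\<close>

definition rcomb :: "nat set \<Rightarrow> bool" where
  "rcomb S \<longleftrightarrow> (\<forall>u\<in>S. \<forall>v\<in>S. \<forall>w\<in>S. u < v \<longrightarrow> v < w \<longrightarrow> level v w < level u v)"

definition lcomb :: "nat set \<Rightarrow> bool" where
  "lcomb S \<longleftrightarrow> (\<forall>u\<in>S. \<forall>v\<in>S. \<forall>w\<in>S. u < v \<longrightarrow> v < w \<longrightarrow> level u v < level v w)"

definition comb :: "nat set \<Rightarrow> bool" where
  "comb S \<longleftrightarrow> rcomb S \<or> lcomb S"

text \<open>
  The root of the subtree spanned by \<open>A \<union> B\<close> separates \<open>A\<close> on its left from \<open>B\<close> on its right.
\<close>

definition split :: "nat set \<Rightarrow> nat set \<Rightarrow> bool" where
  "split A B \<longleftrightarrow> A \<noteq> {} \<and> B \<noteq> {} \<and> (\<exists>l. (\<forall>a\<in>A. \<forall>b\<in>B. a < b \<and> level a b = l) \<and>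
     (\<forall>a\<in>A. \<forall>a'\<in>A. level a a' < l) \<and> (\<forall>b\<in>B. \<forall>b'\<in>B. level b b' < l))"

definition levels :: "nat set \<Rightarrow> nat set" where
  "levels S = {level u v |u v. u \<in> S \<and> v \<in> S \<and> u < v}"

lemma rcomb_mono: "rcomb S \<Longrightarrow> T \<subseteq> S \<Longrightarrow> rcomb T"
  unfolding rcomb_def by blast

lemma lcomb_mono: "lcomb S \<Longrightarrow> T \<subseteq> S \<Longrightarrow> lcomb T"
  unfolding lcomb_def by blast

lemma comb_mono: "comb S \<Longrightarrow> T \<subseteq> S \<Longrightarrow> comb T"
  unfolding comb_def using rcomb_mono lcomb_mono by blast

lemma levels_mono: "T \<subseteq> S \<Longrightarrow> levels T \<subseteq> levels S"
  unfolding levels_def by blast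

lemma splitE:
  assumes "split A B"
  obtains l where "A \<noteq> {}" "B \<noteq> {}" "\<And>a b. a \<in> A \<Longrightarrow> b \<in> B \<Longrightarrow> a < b \<and> level a b = l"
    "\<And>a a'. a \<in> A \<Longrightarrow> a' \<in> A \<Longrightarrow> level a a' < l" "\<And>b b'. b \<in> B \<Longrightarrow> b' \<in> B \<Longrightarrow> level b b' < l"
proof -
  obtain l where "\<forall>a\<in>A. \<forall>b\<in>B. a < b \<and> level a b = l" "\<forall>a\<in>A. \<forall>a'\<in>A. level a a' < l"
    "\<forall>b\<in>B. \<forall>b'\<in>B. level b b' < l" "A \<noteq> {}" "B \<noteq> {}"
    using assms unfolding split_def by (elim conjE exE)
  then show thesis by (intro that[of l]) auto
qed

lemma split_mono:
  assumes "split A B" "A' \<subseteq> A" "B' \<subseteq> B" "A' \<noteq> {}" "B' \<noteq> {}"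
  shows "split A' B'"
proof -
  obtain l where l: "\<forall>a\<in>A. \<forall>b\<in>B. a < b \<and> level a b = l" "\<forall>a\<in>A. \<forall>a'\<in>A. level a a' < l"
    "\<forall>b\<in>B. \<forall>b'\<in>B. level b b' < l"
    using assms(1) unfolding split_def by (elim conjE exE)
  show ?thesis
    unfolding split_def
    by (intro conjI exI[of _ l] ballI) (use assms l in \<open>auto simp: subset_iff\<close>)
qed

lemma split_disjoint: "split A B \<Longrightarrow> A \<inter> B = {}"
  by (erule splitE) (use less_irrefl in blast)

text \<open>
  The right side consists of the elements that branch off from the minimum at the highest level.
\<close>

lemma split_exists:
  assumes "finite S" "2 \<le> card S"
  obtains A B where "split A B" "S = A \<union> B"
proof
  have "S \<noteq> {}" using assms by auto
  define m M where "m = Min S" and "M = Max S"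
  have m: "m \<in> S" "\<And>x. x \<in> S \<Longrightarrow> m \<le> x" and M: "M \<in> S" "\<And>x. x \<in> S \<Longrightarrow> x \<le> M"
    using assms \<open>S \<noteq> {}\<close> by (auto simp: m_def M_def)
  have "m \<noteq> M"
  proof
    assume "m = M"
    then have "S \<subseteq> {m}" using m(2) M(2) by (metis antisym singletonI subsetI)
    then have "card S \<le> card {m}" by (intro card_mono) auto
    then show False using assms by simp
  qed
  define l where "l = level m M"
  have "l > 0" unfolding l_def using \<open>m \<noteq> M\<close> by (rule level_pos)
  have le: "level m x \<le> l" if "x \<in> S" for x
    using level_max[of m x M] m(2)[OF that] M(2)[OF that] by (simp add: l_def)
  define A B where "A = {x \<in> S. level m x < l}" and "B = {x \<in> S. level m x = l}"
  show "S = A \<union> B" using le by (auto simp: A_def B_def nat_less_le)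
  have lt: "a < b" if "a \<in> A" "b \<in> B" for a b
  proof (rule ccontr)
    assume "\<not> a < b"
    then have "level m a = max (level m b) (level b a)"
      using that m by (intro level_max) (auto simp: B_def)
    then show False using that by (auto simp: A_def B_def)
  qed
  show "split A B"
    unfolding split_def
  proof (intro conjI exI[of _ l] ballI)
    show "A \<noteq> {}" using m \<open>l > 0\<close> by (auto simp: A_def intro!: exI[of _ m])
    show "B \<noteq> {}" using M by (auto simp: B_def l_def intro!: exI[of _ M])
    fix a b assume ab: "a \<in> A" "b \<in> B"
    show "a < b" using lt ab .
    then have "level m b = max (level m a) (level a b)"
      using ab m by (intro level_max) (auto simp: A_def)
    then show "level a b = l" using ab by (auto simp: A_def B_def max_def split: if_splits)
  next
    fix a a' assume aa: "a \<in> A" "a' \<in> A"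
    have *: "level x y < l" if "x \<in> A" "y \<in> A" "x \<le> y" for x y
      using level_max[of m x y] that m(2) by (auto simp: A_def)
    show "level a a' < l" using *[OF aa] *[OF aa(2,1)] level_commute[of a a'] by (cases "a \<le> a'") auto
  next
    fix b b' assume bb: "b \<in> B" "b' \<in> B"
    have *: "level x y < l" if "x \<in> B" "y \<in> B" "x < y" for x y
    proof -
      have "m < x" using that m(2)[of x] \<open>l > 0\<close> by (cases "m = x") (auto simp: B_def)
      then have "level m y = max (level m x) (level x y)" "level m x \<noteq> level x y"
        using level_max[of m x y] level_neq[of m x y] that by auto
      then show ?thesis using that by (auto simp: B_def)
    qed
    show "level b b' < l"
      using *[OF bb] *[OF bb(2,1)] level_commute[of b b'] \<open>l > 0\<close> by (cases b b' rule: linorder_cases) auto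
  qed
qed

lemma split_unique:
  assumes "split A B" "split A' B'" "A \<union> B = A' \<union> B'"
  shows "A = A' \<and> B = B'"
proof -
  obtain l where l: "\<forall>a\<in>A. \<forall>b\<in>B. a < b \<and> level a b = l" "\<forall>a\<in>A. \<forall>a'\<in>A. level a a' < l"
      "\<forall>b\<in>B. \<forall>b'\<in>B. level b b' < l" "A \<noteq> {}" "B \<noteq> {}"
    using assms(1) unfolding split_def by auto
  obtain l' where l': "\<forall>a\<in>A'. \<forall>b\<in>B'. a < b \<and> level a b = l'" "\<forall>a\<in>A'. \<forall>a'\<in>A'. level a a' < l'"
      "\<forall>b\<in>B'. \<forall>b'\<in>B'. level b b' < l'" "A' \<noteq> {}" "B' \<noteq> {}"
    using assms(2) unfolding split_def by auto
  have bound: "level x y \<le> l'" "level x y \<le> l" if "x \<in> A \<union> B" "y \<in> A \<union> B" for x y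
  proof -
    show "level x y \<le> l" using that l level_commute[of x y] by (auto simp: less_imp_le)
    have "x \<in> A' \<union> B'" "y \<in> A' \<union> B'" using that assms(3) by auto
    then show "level x y \<le> l'" using l' level_commute[of x y] by (auto simp: less_imp_le)
  qed
  have "l \<le> l'" using bound(1) l by (metis UnCI all_not_in_conv)
  moreover have "l' \<le> l" using bound(2) l' assms(3) by (metis UnCI all_not_in_conv)
  ultimately have "l = l'" by simp
  have "x \<notin> B'" if "x \<in> A" for x
  proof
    assume x: "x \<in> B'"
    obtain a' where a': "a' \<in> A'" using l' by auto
    then have *: "a' < x" "level a' x = l" using l' x \<open>l = l'\<close> by auto
    then have "a' \<notin> A" using l(2) that by (metis less_irrefl)
    then have "a' \<in> B" using a' assms(3) by auto
    then show False using l(1) that * by (metis less_asym)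
  qed
  moreover have "x \<notin> B" if "x \<in> A'" for x
  proof
    assume x: "x \<in> B"
    obtain a where a: "a \<in> A" using l by auto
    then have *: "a < x" "level a x = l'" using l x \<open>l = l'\<close> by auto
    then have "a \<notin> A'" using l'(2) that by (metis less_irrefl)
    then have "a \<in> B'" using a assms(3) by auto
    then show False using l'(1) that * by (metis less_asym)
  qed
  ultimately show ?thesis using assms(3) by blast
qed

lemma card_ge_2_ordered:
  fixes S :: "nat set"
  assumes "2 \<le> card S"
  obtains x y where "x \<in> S" "y \<in> S" "x < y"
proof -
  have "finite S" using assms by (metis card.infinite not_numeral_le_zero)
  obtain T where T: "T \<subseteq> S" "card T = 2" using obtain_subset_with_card_n[OF assms] by metis
  then obtain x y where "T = {x, y}" "x \<noteq> y" by (auto simp: card_2_iff)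
  then show ?thesis using that T by (cases x y rule: linorder_cases) auto
qed

lemma rcomb_split_card:
  assumes "rcomb (A \<union> B)" "split A B"
  shows "\<not> 2 \<le> card A"
proof
  assume "2 \<le> card A"
  then obtain a a' where a: "a \<in> A" "a' \<in> A" "a < a'" by (rule card_ge_2_ordered)
  obtain b where b: "b \<in> B" using assms(2) by (auto simp: split_def)
  have "level a a' < level a' b" "a' < b" using assms(2) a b unfolding split_def by metis+
  then show False using assms(1) a b unfolding rcomb_def by (metis UnCI less_asym)
qed

lemma lcomb_split_card:
  assumes "lcomb (A \<union> B)" "split A B"
  shows "\<not> 2 \<le> card B"
proof
  assume "2 \<le> card B"
  then obtain b b' where b: "b \<in> B" "b' \<in> B" "b < b'" by (rule card_ge_2_ordered)
  obtain a where a: "a \<in> A" using assms(2) by (auto simp: split_def)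
  have "level b b' < level a b" "a < b" using assms(2) a b unfolding split_def by metis+
  then show False using assms(1) a b unfolding lcomb_def by (metis UnCI less_asym)
qed

lemma rcomb_lcomb_card:
  assumes "rcomb S" "lcomb S"
  shows "\<not> 3 \<le> card S"
proof
  assume c: "3 \<le> card S"
  then have fin: "finite S" by (metis card.infinite not_numeral_le_zero)
  have "2 \<le> card S" using c by simp
  with fin obtain A B where AB: "split A B" "S = A \<union> B" by (rule split_exists)
  have "card S \<le> card A + card B" unfolding AB(2) by (rule card_Un_le)
  moreover have "\<not> 2 \<le> card A" "\<not> 2 \<le> card B"
    using rcomb_split_card lcomb_split_card AB assms by metis+
  ultimately show False using c by linarith
qed

lemma rcomb_level_max:
  assumes "rcomb S" "u \<in> S" "v \<in> S" "M \<in> S" "u < v" "v \<le> M"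
  shows "level u v = level u M"
proof (cases "v = M")
  case False
  then have "level v M < level u v" using assms unfolding rcomb_def by auto
  then show ?thesis using level_max[of u v M] assms by simp
qed simp

lemma lcomb_level_min:
  assumes "lcomb S" "u \<in> S" "v \<in> S" "m \<in> S" "u < v" "m \<le> u"
  shows "level u v = level v m"
proof (cases "u = m")
  case True
  then show ?thesis by (simp add: level_commute)
next
  case False
  then have "level m u < level u v" using assms unfolding lcomb_def by auto
  then show ?thesis using level_max[of m u v] level_commute[of v m] assms by simp
qed

text \<open>
  Seen from its lowest end \<open>p\<close>, the maximum of a right comb or the minimum of a left comb, every
  other element of a comb branches off at a level of its own.
\<close>

lemma comb_pivot:
  assumes "comb S" "finite S" "S \<noteq> {}"
  obtains p where "p \<in> S" "inj_on (\<lambda>u. level u p) (S - {p})"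
    "\<And>T. T \<subseteq> S \<Longrightarrow> p \<in> T \<Longrightarrow> levels T = (\<lambda>u. level u p) ` (T - {p})"
  using assms(1) unfolding comb_def
proof
  assume r: "rcomb S"
  define M where "M = Max S"
  have M: "M \<in> S" "\<And>x. x \<in> S \<Longrightarrow> x \<le> M" using assms by (auto simp: M_def)
  show thesis
  proof (rule that[OF M(1)])
    show "inj_on (\<lambda>u. level u M) (S - {M})"
    proof (rule linorder_inj_onI')
      fix u v assume uv: "u \<in> S - {M}" "v \<in> S - {M}" "u < v"
      then have "v < M" using M by (metis DiffE insertI1 order_le_less)
      then have "level v M < level u v" using r uv M unfolding rcomb_def by blast
      then show "level u M \<noteq> level v M"
        using rcomb_level_max[OF r, of u v M] uv M by auto
    qed
    fix T assume T: "T \<subseteq> S" "M \<in> T"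
    show "levels T = (\<lambda>u. level u M) ` (T - {M})"
    proof (intro equalityI subsetI)
      fix x assume "x \<in> levels T"
      then obtain u v where uv: "x = level u v" "u \<in> T" "v \<in> T" "u < v" by (auto simp: levels_def)
      then have "x = level u M" "u \<noteq> M" using rcomb_level_max[OF r, of u v M] T M by (auto simp: subset_iff leD)
      then show "x \<in> (\<lambda>u. level u M) ` (T - {M})" using uv by auto
    next
      fix x assume "x \<in> (\<lambda>u. level u M) ` (T - {M})"
      then obtain u where u: "x = level u M" "u \<in> T" "u \<noteq> M" by auto
      then have "u < M" using T M by (metis order_le_less subsetD)
      then show "x \<in> levels T" using T(2) u(1,2) unfolding levels_def by blast
    qed
  qed
next
  assume r: "lcomb S"
  define M where "M = Min S"
  have M: "M \<in> S" "\<And>x. x \<in> S \<Longrightarrow> M \<le> x" using assms by (auto simp: M_def)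
  show thesis
  proof (rule that[OF M(1)])
    show "inj_on (\<lambda>u. level u M) (S - {M})"
    proof (rule linorder_inj_onI')
      fix u v assume uv: "u \<in> S - {M}" "v \<in> S - {M}" "u < v"
      then have "M < u" using M by (metis DiffE insertI1 order_le_less)
      then have "level M u < level u v" using r uv M unfolding lcomb_def by blast
      then show "level u M \<noteq> level v M"
        using lcomb_level_min[OF r, of u v M] uv M level_commute[of u M] by auto
    qed
    fix T assume T: "T \<subseteq> S" "M \<in> T"
    show "levels T = (\<lambda>u. level u M) ` (T - {M})"
    proof (intro equalityI subsetI)
      fix x assume "x \<in> levels T"
      then obtain u v where uv: "x = level u v" "u \<in> T" "v \<in> T" "u < v" by (auto simp: levels_def)
      then have "x = level v M" "v \<noteq> M" using lcomb_level_min[OF r, of u v M] T M by (auto simp: subset_iff leD)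
      then show "x \<in> (\<lambda>u. level u M) ` (T - {M})" using uv by auto
    next
      fix x assume "x \<in> (\<lambda>u. level u M) ` (T - {M})"
      then obtain u where u: "x = level M u" "u \<in> T" "u \<noteq> M" by (auto simp: level_commute)
      then have "M < u" using T M by (metis order_le_less subsetD)
      then show "x \<in> levels T" using T(2) u(1,2) unfolding levels_def by blast
    qed
  qed
qed

lemma card_levels_comb:
  assumes "comb S" "finite S" "S \<noteq> {}"
  shows "card (levels S) = card S - 1"
proof -
  obtain p where p: "p \<in> S" "inj_on (\<lambda>u. level u p) (S - {p})"
    "\<And>T. T \<subseteq> S \<Longrightarrow> p \<in> T \<Longrightarrow> levels T = (\<lambda>u. level u p) ` (T - {p})"
    using comb_pivot[OF assms] by blast
  then show ?thesis using assms by (simp add: card_image)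
qed

text \<open>
  Hence the subsets of a comb realise all sets of its levels. With \<open>card_levels_comb\<close> this is the
  dictionary between cliques in a comb and cliques among its levels.
\<close>

lemma comb_with_levels:
  assumes "comb S" "finite S" "S \<noteq> {}" "K \<subseteq> levels S"
  obtains T where "T \<subseteq> S" "levels T = K" "card T = Suc (card K)"
proof -
  obtain p where p: "p \<in> S" "inj_on (\<lambda>u. level u p) (S - {p})"
    "\<And>T. T \<subseteq> S \<Longrightarrow> p \<in> T \<Longrightarrow> levels T = (\<lambda>u. level u p) ` (T - {p})"
    using comb_pivot[OF assms(1-3)] by blast
  have "K \<subseteq> (\<lambda>u. level u p) ` (S - {p})" using assms(4) p(3)[OF subset_refl p(1)] by simp
  then obtain T' where T': "T' \<subseteq> S - {p}" "K = (\<lambda>u. level u p) ` T'" by (meson subset_imageE)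
  then have "p \<notin> T'" by auto
  show thesis
  proof (rule that[of "insert p T'"])
    show "insert p T' \<subseteq> S" using T' p by auto
    then show "levels (insert p T') = K" using p(3)[of "insert p T'"] T' \<open>p \<notin> T'\<close> by simp
    have "card K = card T'" unfolding T'(2) using T'(1) p(2) by (intro card_image) (rule inj_on_subset)
    then show "card (insert p T') = Suc (card K)"
      using \<open>p \<notin> T'\<close> T' assms(2) by (metis Diff_subset card_insert_disjoint finite_subset order_trans)
  qed
qed

lemma rcomb_insert:
  assumes "split A B" "rcomb S" "S \<subseteq> B" "a \<in> A"
  shows "rcomb (insert a S)"
proof -
  obtain l where l: "\<forall>b\<in>B. a < b \<and> level a b = l" "\<forall>b\<in>B. \<forall>b'\<in>B. level b b' < l"
    using assms(1,4) unfolding split_def by auto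
  show ?thesis
    unfolding rcomb_def
  proof (intro ballI impI)
    fix u v w assume uvw: "u \<in> insert a S" "v \<in> insert a S" "w \<in> insert a S" "u < v" "v < w"
    have "v \<noteq> a" "w \<noteq> a" using uvw l(1) assms(3) by (metis insert_iff less_asym less_irrefl less_trans subsetD)+
    then have vw: "v \<in> S" "w \<in> S" using uvw by auto
    show "level v w < level u v"
    proof (cases "u = a")
      case True then show ?thesis using l vw assms(3) by (metis subsetD)
    next
      case False then show ?thesis using uvw vw assms(2) unfolding rcomb_def by blast
    qed
  qed
qed

lemma lcomb_insert:
  assumes "split A B" "lcomb S" "S \<subseteq> A" "b \<in> B"
  shows "lcomb (insert b S)"
proof -
  obtain l where l: "\<forall>a\<in>A. a < b \<and> level a b = l" "\<forall>a\<in>A. \<forall>a'\<in>A. level a a' < l"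
    using assms(1,4) unfolding split_def by auto
  show ?thesis
    unfolding lcomb_def
  proof (intro ballI impI)
    fix u v w assume uvw: "u \<in> insert b S" "v \<in> insert b S" "w \<in> insert b S" "u < v" "v < w"
    have "u \<noteq> b" "v \<noteq> b" using uvw l(1) assms(3) by (metis insert_iff less_asym less_irrefl less_trans subsetD)+
    then have uv: "u \<in> S" "v \<in> S" using uvw by auto
    show "level u v < level v w"
    proof (cases "w = b")
      case True then show ?thesis using l uv assms(3) by (metis subsetD)
    next
      case False then show ?thesis using uvw uv assms(2) unfolding lcomb_def by blast
    qed
  qed
qed

lemma no_lcomb_left:
  assumes "split A B" "finite A" "\<not> (\<exists>S\<subseteq>A \<union> B. lcomb S \<and> card S = Suc j)"
  shows "\<not> (\<exists>S\<subseteq>A. lcomb S \<and> card S = j)"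
proof
  assume "\<exists>S\<subseteq>A. lcomb S \<and> card S = j"
  then obtain S where S: "S \<subseteq> A" "lcomb S" "card S = j" by blast
  obtain b where b: "b \<in> B" using assms(1) by (auto simp: split_def)
  have "b \<notin> S" using S b split_disjoint[OF assms(1)] by auto
  then have "card (insert b S) = Suc j" using S assms(2) finite_subset by (subst card_insert_disjoint) auto
  moreover have "lcomb (insert b S)" using lcomb_insert[OF assms(1) S(2,1) b] .
  moreover have "insert b S \<subseteq> A \<union> B" using S b by auto
  ultimately show False using assms(3) by blast
qed

lemma no_rcomb_right:
  assumes "split A B" "finite B" "\<not> (\<exists>S\<subseteq>A \<union> B. rcomb S \<and> card S = Suc i)"
  shows "\<not> (\<exists>S\<subseteq>B. rcomb S \<and> card S = i)"
proof
  assume "\<exists>S\<subseteq>B. rcomb S \<and> card S = i"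
  then obtain S where S: "S \<subseteq> B" "rcomb S" "card S = i" by blast
  obtain a where a: "a \<in> A" using assms(1) by (auto simp: split_def)
  have "a \<notin> S" using S a split_disjoint[OF assms(1)] by auto
  then have "card (insert a S) = Suc i" using S assms(2) finite_subset by (subst card_insert_disjoint) auto
  moreover have "rcomb (insert a S)" using rcomb_insert[OF assms(1) S(2,1) a] .
  moreover have "insert a S \<subseteq> A \<union> B" using S a by auto
  ultimately show False using assms(3) by blast
qed

lemma rcomb_empty [simp]: "rcomb {}" and lcomb_empty [simp]: "lcomb {}"
  by (simp_all add: rcomb_def lcomb_def)

text \<open>
  If \<open>W\<close> has neither a right comb of size \<open>i\<close> nor a left comb of size \<open>j\<close>, then the left part
  of its root split has no left comb of size \<open>j - 1\<close> and the right part no right comb of size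
  \<open>i - 1\<close>. So any function satisfying the corresponding recursion is a bound.
\<close>

lemma comb_ramsey:
  fixes g :: "nat \<Rightarrow> nat \<Rightarrow> nat"
  assumes g: "\<And>i j. g i (Suc j) + g (Suc i) j \<le> g (Suc i) (Suc j)"
    and g1: "\<And>i j. 1 \<le> g (Suc i) (Suc j)"
  shows "finite W \<Longrightarrow> \<not> (\<exists>S\<subseteq>W. rcomb S \<and> card S = i) \<Longrightarrow> \<not> (\<exists>S\<subseteq>W. lcomb S \<and> card S = j)
    \<Longrightarrow> card W \<le> g i j"
proof (induction "i + j" arbitrary: i j W)
  case 0
  then have "i = 0" by simp
  then show ?case using 0(3) by (metis card.empty empty_subsetI rcomb_empty)
next
  case (Suc n)
  have "i \<noteq> 0" using Suc.prems(2) by (metis card.empty empty_subsetI rcomb_empty)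
  moreover have "j \<noteq> 0" using Suc.prems(3) by (metis card.empty empty_subsetI lcomb_empty)
  ultimately obtain i' j' where ij: "i = Suc i'" "j = Suc j'" by (metis not0_implies_Suc)
  show ?case
  proof (cases "2 \<le> card W")
    case False
    then show ?thesis using g1[of i' j'] unfolding ij by linarith
  next
    case True
    then obtain A B where AB: "split A B" "W = A \<union> B" using split_exists Suc.prems(1) by metis
    have "finite A" "finite B" using Suc.prems(1) AB by auto
    have "card A \<le> g i j'"
    proof (rule Suc.hyps(1))
      show "n = i + j'" using Suc.hyps(2) ij by simp
      show "finite A" by fact
      show "\<not> (\<exists>S\<subseteq>A. rcomb S \<and> card S = i)" using Suc.prems(2) AB by blast
      show "\<not> (\<exists>S\<subseteq>A. lcomb S \<and> card S = j')"
        using no_lcomb_left[OF AB(1) \<open>finite A\<close>] Suc.prems(3) unfolding AB(2) ij .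
    qed
    moreover have "card B \<le> g i' j"
    proof (rule Suc.hyps(1))
      show "n = i' + j" using Suc.hyps(2) ij by simp
      show "finite B" by fact
      show "\<not> (\<exists>S\<subseteq>B. lcomb S \<and> card S = j)" using Suc.prems(3) AB by blast
      show "\<not> (\<exists>S\<subseteq>B. rcomb S \<and> card S = i')"
        using no_rcomb_right[OF AB(1) \<open>finite B\<close>] Suc.prems(2) unfolding AB(2) ij .
    qed
    moreover have "card W \<le> card A + card B" unfolding AB(2) by (rule card_Un_le)
    ultimately show ?thesis using g[of i' j'] unfolding ij by simp
  qed
qed

section \<open>Stepping up\<close>

text \<open>
  The property of \<open>n\<close> and \<open>s\<close> which is stepped up. It makes the Erdos-Rogers function at \<open>n\<close> less
  than \<open>s\<close> (\<open>erdos_rogers_less\<close>), and unlike that function it is visibly monotone in both.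
\<close>

definition er_witness :: "nat \<Rightarrow> nat \<Rightarrow> nat \<Rightarrow> bool" where
  "er_witness k n s \<longleftrightarrow> (\<exists>E. complete_free k (k + 2) {..<n} E \<and>
     (\<forall>W\<subseteq>{..<n}. s \<le> card W \<longrightarrow> \<not> complete_free k (k + 1) W E))"

text \<open>
  The set \<open>F\<close> lists the sizes of the two sides of those balanced sets that are edges regardless
  of \<open>G\<close>.
\<close>

definition step_edges :: "nat \<Rightarrow> (nat \<times> nat) set \<Rightarrow> nat set set \<Rightarrow> nat set set" where
  "step_edges k F G = {e. card e = k \<and> (comb e \<and> levels e \<in> G \<or>
     (\<exists>A B. e = A \<union> B \<and> split A B \<and> rcomb A \<and> lcomb B \<and> (card A, card B) \<in> F))}"

text \<open>
  An edge with a single element on one side of the root must be a comb, since all sides allowed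
  by \<open>F\<close> have at least two elements.
\<close>

lemma step_edge_unbalanced:
  assumes e: "A \<union> B \<in> step_edges k F G" and AB: "split A B" and F: "\<And>p q. (p, q) \<in> F \<Longrightarrow> 2 \<le> p \<and> 2 \<le> q"
  shows "card A = 1 \<Longrightarrow> 2 \<le> card B \<Longrightarrow> rcomb (A \<union> B) \<and> levels (A \<union> B) \<in> G"
    and "card B = 1 \<Longrightarrow> 2 \<le> card A \<Longrightarrow> lcomb (A \<union> B) \<and> levels (A \<union> B) \<in> G"
proof -
  have *: "2 \<le> card A \<and> 2 \<le> card B" if "A \<union> B = A' \<union> B'" "split A' B'" "(card A', card B') \<in> F" for A' B'
    using split_unique[OF AB that(2,1)] F[OF that(3)] by simp
  { assume "card A = 1" "2 \<le> card B"
    then show "rcomb (A \<union> B) \<and> levels (A \<union> B) \<in> G"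
      using e * lcomb_split_card[OF _ AB] unfolding step_edges_def comb_def by force }
  { assume "card B = 1" "2 \<le> card A"
    then show "lcomb (A \<union> B) \<and> levels (A \<union> B) \<in> G"
      using e * rcomb_split_card[OF _ AB] unfolding step_edges_def comb_def by force }
qed

lemma step_edge_balanced:
  assumes e: "A \<union> B \<in> step_edges k F G" and AB: "split A B" and "2 \<le> card A" "2 \<le> card B"
  shows "rcomb A \<and> lcomb B \<and> (card A, card B) \<in> F"
proof -
  have "\<not> comb (A \<union> B)"
    using rcomb_split_card[OF _ AB] lcomb_split_card[OF _ AB] assms by (auto simp: comb_def)
  then obtain A' B' where "A \<union> B = A' \<union> B'" "split A' B'" "rcomb A'" "lcomb B'" "(card A', card B') \<in> F"
    using e by (auto simp: step_edges_def)
  then show ?thesis using split_unique[OF AB, of A' B'] by simp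
qed

lemma comb_step_edge:
  assumes "comb e" "e \<in> step_edges k F G" and F: "\<And>p q. (p, q) \<in> F \<Longrightarrow> 2 \<le> p \<and> 2 \<le> q"
  shows "levels e \<in> G"
proof -
  have False if "e = A \<union> B" "split A B" "(card A, card B) \<in> F" for A B
    using that assms(1) F[OF that(3)] rcomb_split_card lcomb_split_card unfolding comb_def by blast
  then show ?thesis using assms unfolding step_edges_def by blast
qed

lemma comb_no_clique:
  assumes k: "2 \<le> k" and G: "complete_free (k - 1) (k + 1) V G" and U: "comb U" "card U = k + 2" "levels U \<subseteq> V"
    and edges: "nsets U k \<subseteq> step_edges k F G" and F: "\<And>p q. (p, q) \<in> F \<Longrightarrow> 2 \<le> p \<and> 2 \<le> q"
  shows False
proof -
  have fin: "finite U" "U \<noteq> {}" using U(2) by (auto intro: card_ge_0_finite)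
  have "card (levels U) = k + 1" using card_levels_comb[of U] U fin by simp
  then have "levels U \<in> nsets V (k + 1)"
    using U(3) by (auto simp: nsets_def intro: card_ge_0_finite)
  moreover have "nsets (levels U) (k - 1) \<subseteq> G"
  proof
    fix K assume "K \<in> nsets (levels U) (k - 1)"
    then have K: "K \<subseteq> levels U" "card K = k - 1" by (auto simp: nsets_def)
    obtain T where T: "T \<subseteq> U" "levels T = K" "card T = Suc (card K)"
      using comb_with_levels[OF U(1) fin K(1)] by metis
    then have "T \<in> nsets U k" using K(2) k fin by (auto simp: nsets_def intro: finite_subset)
    then show "K \<in> G" using comb_step_edge[OF comb_mono[OF U(1) T(1)] _ F] edges T(2) by blast
  qed
  ultimately show False using G unfolding complete_free_def by blast
qed

lemma comb_has_clique:
  assumes k: "2 \<le> k" and S: "comb S" "finite S" "S \<noteq> {}"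
    and G: "\<not> complete_free (k - 1) k (levels S) G"
  shows "\<not> complete_free k (k + 1) S (step_edges k F G)"
proof -
  obtain K where K: "K \<subseteq> levels S" "finite K" "card K = k" "nsets K (k - 1) \<subseteq> G"
    using G unfolding complete_free_def nsets_def by blast
  obtain T where T: "T \<subseteq> S" "levels T = K" "card T = Suc (card K)"
    using comb_with_levels[OF S K(1)] by metis
  have finT: "finite T" using T S finite_subset by blast
  have "nsets T k \<subseteq> step_edges k F G"
  proof
    fix e assume "e \<in> nsets T k"
    then have e: "e \<subseteq> T" "card e = k" "finite e" by (auto simp: nsets_def)
    then have "e \<noteq> {}" using k by auto
    have "comb e" using comb_mono S(1) e(1) T(1) by blast
    then have "card (levels e) = k - 1" using card_levels_comb[of e] e \<open>e \<noteq> {}\<close> by simp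
    moreover have "levels e \<subseteq> K" using levels_mono[OF e(1)] T(2) by simp
    ultimately have "levels e \<in> nsets K (k - 1)" using K(2) by (auto simp: nsets_def intro: finite_subset)
    then show "e \<in> step_edges k F G" using K(4) e \<open>comb e\<close> by (auto simp: step_edges_def)
  qed
  moreover have "T \<in> nsets S (k + 1)" using T K finT by (auto simp: nsets_def)
  ultimately show ?thesis unfolding complete_free_def by blast
qed

text \<open>
  If one side of the root of a clique is a single vertex, then all \<open>k\<close>-subsets containing this
  vertex are combs. Since \<open>k \<ge> 4\<close>, any three vertices lie in such a subset, so the whole clique
  is a comb and \<open>comb_no_clique\<close> applies.
\<close>

lemma unbalanced_no_clique:
  assumes k: "4 \<le> k" and G: "complete_free (k - 1) (k + 1) V G" and U: "card (A \<union> B) = k + 2" "levels (A \<union> B) \<subseteq> V"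
    and edges: "nsets (A \<union> B) k \<subseteq> step_edges k F G" and F: "\<And>p q. (p, q) \<in> F \<Longrightarrow> 2 \<le> p \<and> 2 \<le> q"
    and AB: "split A B" and one: "card A = 1 \<or> card B = 1"
  shows False
proof -
  have fin: "finite (A \<union> B)" using U(1) by (metis add_is_0 card.infinite zero_neq_numeral)
  have dis: "A \<inter> B = {}" using split_disjoint[OF AB] .
  have cU: "card A + card B = k + 2" using U(1) fin dis by (simp add: card_Un_disjoint)
  have "comb (A \<union> B)"
    using one
  proof
    assume A: "card A = 1"
    have "level v w < level u v" if uvw: "u \<in> A \<union> B" "v \<in> A \<union> B" "w \<in> A \<union> B" "u < v" "v < w" for u v w
    proof -
      have "card (A \<union> {u, v, w}) \<le> card A + card {u, v, w}" by (rule card_Un_le)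
      also have "card {u, v, w} \<le> 3" by (simp add: card_insert_if)
      finally have "card (A \<union> {u, v, w}) \<le> k" using A k by simp
      then obtain e where e: "A \<union> {u, v, w} \<subseteq> e" "e \<subseteq> A \<union> B" "card e = k"
        using exists_subset_between[of "A \<union> {u, v, w}" k "A \<union> B"] fin uvw U(1) by auto
      define B' where "B' = e \<inter> B"
      have e_eq: "e = A \<union> B'" and "finite B'" using e fin by (auto simp: B'_def)
      have "card e = card A + card B'"
        unfolding e_eq using fin dis \<open>finite B'\<close> by (intro card_Un_disjoint) (auto simp: B'_def)
      then have cB': "2 \<le> card B'" using e(3) A k by simp
      then have "B' \<noteq> {}" by auto
      then have sp: "split A B'" using AB by (intro split_mono[OF AB]) (auto simp: B'_def split_def)
      have "e \<in> nsets (A \<union> B) k" using e fin by (auto simp: nsets_def intro: finite_subset)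
      then have "A \<union> B' \<in> step_edges k F G" using edges e_eq by blast
      then have "rcomb e" using step_edge_unbalanced(1)[OF _ sp F A cB'] e_eq by simp
      then show ?thesis using e(1) uvw(4,5) unfolding rcomb_def by blast
    qed
    then show ?thesis unfolding comb_def rcomb_def by blast
  next
    assume B: "card B = 1"
    have "level u v < level v w" if uvw: "u \<in> A \<union> B" "v \<in> A \<union> B" "w \<in> A \<union> B" "u < v" "v < w" for u v w
    proof -
      have "card (B \<union> {u, v, w}) \<le> card B + card {u, v, w}" by (rule card_Un_le)
      also have "card {u, v, w} \<le> 3" by (simp add: card_insert_if)
      finally have "card (B \<union> {u, v, w}) \<le> k" using B k by simp
      then obtain e where e: "B \<union> {u, v, w} \<subseteq> e" "e \<subseteq> A \<union> B" "card e = k"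
        using exists_subset_between[of "B \<union> {u, v, w}" k "A \<union> B"] fin uvw U(1) by auto
      define A' where "A' = e \<inter> A"
      have e_eq: "e = A' \<union> B" and "finite A'" using e fin by (auto simp: A'_def)
      have "card e = card A' + card B"
        unfolding e_eq using fin dis \<open>finite A'\<close> by (intro card_Un_disjoint) (auto simp: A'_def)
      then have cA': "2 \<le> card A'" using e(3) B k by simp
      then have "A' \<noteq> {}" by auto
      then have sp: "split A' B" using AB by (intro split_mono[OF AB]) (auto simp: A'_def split_def)
      have "e \<in> nsets (A \<union> B) k" using e fin by (auto simp: nsets_def intro: finite_subset)
      then have "A' \<union> B \<in> step_edges k F G" using edges e_eq by blast
      then have "lcomb e" using step_edge_unbalanced(2)[OF _ sp F B cA'] e_eq by simp
      then show ?thesis using e(1) uvw(4,5) unfolding lcomb_def by blast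
    qed
    then show ?thesis unfolding comb_def lcomb_def by blast
  qed
  then show False using comb_no_clique[OF _ G _ U edges F] k by simp
qed

lemma levels_bound: "S \<subseteq> {..<2 ^ N} \<Longrightarrow> levels S \<subseteq> {..<Suc N}"
  unfolding levels_def by (auto simp: subset_iff less_Suc_eq_le intro!: level_le)

text \<open>
  The part of the stepping-up argument which does not depend on \<open>F\<close>. It remains to exclude
  balanced cliques on \<open>k + 2\<close> vertices and to find cliques on \<open>k + 1\<close> vertices in sets without
  combs of size \<open>s + 1\<close>.
\<close>

lemma step_up:
  assumes k: "4 \<le> k" and G: "er_witness (k - 1) (Suc N) s" and F: "\<And>p q. (p, q) \<in> F \<Longrightarrow> 2 \<le> p \<and> 2 \<le> q"
    and balanced: "\<And>A B G. split A B \<Longrightarrow> card A + card B = k + 2 \<Longrightarrow> 2 \<le> card A \<Longrightarrow> 2 \<le> card B \<Longrightarrow>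
      (\<And>A' B'. A' \<subseteq> A \<Longrightarrow> B' \<subseteq> B \<Longrightarrow> card A' + card B' = k \<Longrightarrow> A' \<union> B' \<in> step_edges k F G) \<Longrightarrow> False"
    and large: "\<And>W G. finite W \<Longrightarrow> s' \<le> card W \<Longrightarrow> \<not> (\<exists>S\<subseteq>W. comb S \<and> card S = Suc s) \<Longrightarrow>
      \<not> complete_free k (k + 1) W (step_edges k F G)"
  shows "er_witness k (2 ^ N) s'"
proof -
  obtain G where G1: "complete_free (k - 1) (k + 1) {..<Suc N} G"
    and G2: "\<And>W. W \<subseteq> {..<Suc N} \<Longrightarrow> s \<le> card W \<Longrightarrow> \<not> complete_free (k - 1) k W G"
    using G k unfolding er_witness_def by auto
  have "complete_free k (k + 2) {..<2 ^ N} (step_edges k F G)"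
    unfolding complete_free_def
  proof
    assume "\<exists>U\<in>nsets {..<2 ^ N} (k + 2). nsets U k \<subseteq> step_edges k F G"
    then obtain U where U: "U \<subseteq> {..<2 ^ N}" "finite U" "card U = k + 2" "nsets U k \<subseteq> step_edges k F G"
      by (auto simp: nsets_def)
    obtain A B where AB: "split A B" "U = A \<union> B" using split_exists[of U] U by auto
    have fin: "finite A" "finite B" using U AB by auto
    have dis: "A \<inter> B = {}" using split_disjoint[OF AB(1)] .
    have c: "card A + card B = k + 2" using U(3) AB fin dis by (simp add: card_Un_disjoint)
    have "card A \<noteq> 0" "card B \<noteq> 0" using AB fin by (auto simp: split_def)
    show False
    proof (cases "card A = 1 \<or> card B = 1")
      case True
      show False
        by (rule unbalanced_no_clique[OF k G1 _ _ _ F AB(1) True])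
           (use U AB levels_bound in auto)
    next
      case False
      show False
      proof (rule balanced[OF AB(1) c])
        show "2 \<le> card A" "2 \<le> card B" using False \<open>card A \<noteq> 0\<close> \<open>card B \<noteq> 0\<close> by linarith+
        fix A' B' assume A'B': "A' \<subseteq> A" "B' \<subseteq> B" "card A' + card B' = k"
        then have "finite A'" "finite B'" "A' \<inter> B' = {}" using fin finite_subset dis by blast+
        then have "A' \<union> B' \<in> nsets U k"
          using A'B' AB by (auto simp: nsets_def card_Un_disjoint)
        then show "A' \<union> B' \<in> step_edges k F G" using U by blast
      qed
    qed
  qed
  moreover have "\<not> complete_free k (k + 1) W (step_edges k F G)" if W: "W \<subseteq> {..<2 ^ N}" "s' \<le> card W" for W
  proof (cases "\<exists>S\<subseteq>W. comb S \<and> card S = Suc s")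
    case True
    then obtain S where S: "S \<subseteq> W" "comb S" "card S = Suc s" by blast
    then have fin: "finite S" "S \<noteq> {}" by (auto intro: card_ge_0_finite)
    have "card (levels S) = s" using card_levels_comb[OF S(2) fin] S by simp
    then have "\<not> complete_free (k - 1) k (levels S) G"
      using G2[of "levels S"] levels_bound[of S N] S W by auto
    then have "\<not> complete_free k (k + 1) S (step_edges k F G)"
      using comb_has_clique S fin k by auto
    then show ?thesis using nsets_mono[OF S(1), of "k + 1"] unfolding complete_free_def by blast
  next
    case False
    then show ?thesis using large[of W G] W finite_subset by auto
  qed
  ultimately show ?thesis unfolding er_witness_def by blast
qed

text \<open>
  Here the balanced sets are never edges, and a balanced set contains one with two vertices on
  each side of the root.
\<close>

lemma step_up_from_3:
  assumes "er_witness 3 (Suc N) s"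
  shows "er_witness 4 (2 ^ N) (Suc (2 ^ (2 * Suc s)))"
proof (rule step_up[where F = "{}" and s = s])
  show "er_witness (4 - 1) (Suc N) s" using assms by simp
  fix A B G assume AB: "split A B" "2 \<le> card A" "2 \<le> card B"
    and edges: "\<And>A' B'. A' \<subseteq> A \<Longrightarrow> B' \<subseteq> B \<Longrightarrow> card A' + card B' = 4 \<Longrightarrow> A' \<union> B' \<in> step_edges 4 {} G"
  obtain A' B' where A'B': "A' \<subseteq> A" "card A' = 2" "B' \<subseteq> B" "card B' = 2"
    using obtain_subset_with_card_n AB by metis
  then have "split A' B'" using AB by (intro split_mono[OF AB(1)]) auto
  moreover have "A' \<union> B' \<in> step_edges 4 {} G" using A'B' by (intro edges) auto
  ultimately show False using step_edge_balanced[of A' B' 4 "{}" G] A'B' by simp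
next
  fix W :: "nat set" and G assume W: "finite W" "Suc (2 ^ (2 * Suc s)) \<le> card W" "\<not> (\<exists>S\<subseteq>W. comb S \<and> card S = Suc s)"
  then have "card W \<le> 2 ^ (Suc s + Suc s)"
    using comb_ramsey[of "\<lambda>i j. 2 ^ (i + j)" W "Suc s" "Suc s"] unfolding comb_def by auto
  then show "\<not> complete_free 4 (4 + 1) W (step_edges 4 {} G)" using W by (simp add: mult_2)
qed auto

text \<open>
  Polynomial bounds when one of the two comb sizes is fixed.
\<close>

lemma comb_ramsey_power:
  assumes "finite W" "\<not> (\<exists>S\<subseteq>W. rcomb S \<and> card S = i)" "\<not> (\<exists>S\<subseteq>W. lcomb S \<and> card S = j)"
  shows "card W \<le> i ^ j" "card W \<le> j ^ i"
proof -
  have le: "n ^ Suc m + Suc n ^ m \<le> Suc n ^ Suc m" for n m :: nat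
  proof -
    have "n ^ Suc m \<le> n * Suc n ^ m" by (simp add: power_mono)
    then show ?thesis by simp
  qed
  have one: "1 \<le> Suc n ^ m" for n m by (rule one_le_power) simp
  show "card W \<le> i ^ j"
    using assms le one by (intro comb_ramsey[of "\<lambda>i j. i ^ j"]) (auto simp: add.commute simp del: power_Suc)
  show "card W \<le> j ^ i"
    using assms le one by (intro comb_ramsey[of "\<lambda>i j. j ^ i"]) (auto simp: add.commute simp del: power_Suc)
qed

text \<open>
  Without the pattern, at every branching either the left side has no right comb of size 3 or
  the right side has no left comb of size \<open>b\<close>; as combs of size \<open>h\<close> are absent as well, that side
  has at most \<open>h ^ b\<close> elements by \<open>comb_ramsey_power\<close>. Following the other side one meets at most
  \<open>i + j\<close> branchings, since each of them extends a right or a left comb.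
\<close>

lemma card_le_without_balanced_pattern:
  assumes b: "3 \<le> b"
  shows "finite W \<Longrightarrow> i \<le> h \<Longrightarrow> j \<le> h \<Longrightarrow> \<not> (\<exists>S\<subseteq>W. rcomb S \<and> card S = i) \<Longrightarrow> \<not> (\<exists>S\<subseteq>W. lcomb S \<and> card S = j) \<Longrightarrow>
    \<not> (\<exists>A B. A \<union> B \<subseteq> W \<and> split A B \<and> rcomb A \<and> lcomb B \<and> card A = 3 \<and> card B = b) \<Longrightarrow>
    card W \<le> (i + j) * h ^ b"
proof (induction "i + j" arbitrary: i j W)
  case 0
  then have "i = 0" by simp
  then show ?case using 0(5) by (metis card.empty empty_subsetI rcomb_empty)
next
  case (Suc n)
  have "i \<noteq> 0" using Suc.prems(4) by (metis card.empty empty_subsetI rcomb_empty)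
  moreover have "j \<noteq> 0" using Suc.prems(5) by (metis card.empty empty_subsetI lcomb_empty)
  ultimately obtain i' j' where ij: "i = Suc i'" "j = Suc j'" by (metis not0_implies_Suc)
  have "h > 0" using Suc.prems ij by simp
  show ?case
  proof (cases "2 \<le> card W")
    case False
    have "1 * 1 \<le> (i + j) * h ^ b" using ij \<open>h > 0\<close> by (intro mult_le_mono) auto
    then show ?thesis using False by linarith
  next
    case True
    then obtain A B where AB: "split A B" "W = A \<union> B" using split_exists Suc.prems(1) by metis
    have fin: "finite A" "finite B" using Suc.prems(1) AB by auto
    have noA: "\<not> (\<exists>S\<subseteq>A. lcomb S \<and> card S = j')"
      using no_lcomb_left[OF AB(1) fin(1)] Suc.prems(5) unfolding AB(2) ij .
    have noB: "\<not> (\<exists>S\<subseteq>B. rcomb S \<and> card S = i')"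
      using no_rcomb_right[OF AB(1) fin(2)] Suc.prems(4) unfolding AB(2) ij .
    have sub: "A \<subseteq> W" "B \<subseteq> W" using AB by auto
    have mono: "\<not> (\<exists>S\<subseteq>X. P S)" if "\<not> (\<exists>S\<subseteq>W. P S)" "X \<subseteq> W" for X and P :: "nat set \<Rightarrow> bool"
      using that by (meson order_trans)
    note AW = mono[OF Suc.prems(4) sub(1)] mono[OF Suc.prems(5) sub(1)]
      mono[OF Suc.prems(4) sub(2)] mono[OF Suc.prems(5) sub(2)]
    have pat: "\<not> (\<exists>A' B'. A' \<union> B' \<subseteq> X \<and> split A' B' \<and> rcomb A' \<and> lcomb B' \<and> card A' = 3 \<and> card B' = b)"
      if "X \<subseteq> W" for X
    proof (intro notI, elim exE conjE)
      fix A' B' assume "A' \<union> B' \<subseteq> X" "split A' B'" "rcomb A'" "lcomb B'" "card A' = 3" "card B' = b"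
      moreover from this have "A' \<union> B' \<subseteq> W" using that by (meson order_trans)
      ultimately show False using Suc.prems(6) by blast
    qed
    have cW: "card W \<le> card A + card B" unfolding AB(2) by (rule card_Un_le)
    show ?thesis
    proof (cases "\<exists>S\<subseteq>A. rcomb S \<and> card S = 3")
      case True
      then obtain S where S: "S \<subseteq> A" "rcomb S" "card S = 3" by blast
      have "\<not> (\<exists>T\<subseteq>B. lcomb T \<and> card T = b)"
      proof
        assume "\<exists>T\<subseteq>B. lcomb T \<and> card T = b"
        then obtain T where T: "T \<subseteq> B" "lcomb T" "card T = b" by blast
        have "split S T" using S T b by (intro split_mono[OF AB(1)]) auto
        moreover have "S \<union> T \<subseteq> W" using S T sub by blast
        ultimately show False using Suc.prems(6) S T by blast
      qed
      then have "card B \<le> i ^ b" using comb_ramsey_power(1)[OF fin(2) AW(3)] by blast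
      also have "\<dots> \<le> h ^ b" using Suc.prems by (intro power_mono) auto
      finally have "card B \<le> h ^ b" .
      moreover have "card A \<le> (i + j') * h ^ b"
        proof (rule Suc.hyps(1)[OF _ fin(1) _ _ AW(1) noA pat[OF sub(1)]])
        show "n = i + j'" "i \<le> h" "j' \<le> h" using Suc.hyps(2) Suc.prems(2,3) ij by simp_all
      qed
      ultimately show ?thesis using cW ij by (simp add: algebra_simps)
    next
      case False
      then have "card A \<le> j ^ 3" using comb_ramsey_power(2)[OF fin(1) _ AW(2)] by blast
      also have "\<dots> \<le> h ^ 3" using Suc.prems by (intro power_mono) auto
      also have "\<dots> \<le> h ^ b" using \<open>h > 0\<close> b by (intro power_increasing) auto
      finally have "card A \<le> h ^ b" .
      moreover have "card B \<le> (i' + j) * h ^ b"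
        proof (rule Suc.hyps(1)[OF _ fin(2) _ _ noB AW(4) pat[OF sub(2)]])
        show "n = i' + j" "i' \<le> h" "j \<le> h" using Suc.hyps(2) Suc.prems(2,3) ij by simp_all
      qed
      ultimately show ?thesis using cW ij by (simp add: algebra_simps)
    qed
  qed
qed

text \<open>
  Deleting a vertex from the pattern with a right comb of size 3 on the left and a left comb of
  size \<open>k - 2\<close> on the right leaves the side sizes \<open>(2, k - 2)\<close> or \<open>(3, k - 3)\<close>, so the pattern is
  a clique. A balanced clique on \<open>k + 2\<close> vertices cannot have four vertices on each side, because
  removing two vertices on the right would then leave forbidden side sizes. If a side has at most
  three vertices, the other one has at least \<open>k - 1\<close>, and it would contain at least \<open>k - 2 \<ge> 3\<close>
  vertices forming both a left and a right comb: one kind is enforced by the edges that meet the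
  small side in a single vertex, the other by those that meet it in two.
\<close>

lemma step_up_polynomial:
  assumes k: "5 \<le> k" and w: "er_witness (k - 1) (Suc N) s" and "1 \<le> s"
  shows "er_witness k (2 ^ N) ((4 * s) ^ k)"
proof (rule step_up[where F = "{(2, k - 2), (3, k - 3)}" and s = s])
  show "4 \<le> k" "er_witness (k - 1) (Suc N) s" using k w by auto
  show "2 \<le> p \<and> 2 \<le> q" if "(p, q) \<in> {(2, k - 2), (3, k - 3)}" for p q :: nat using that k by auto
next
  fix A B G assume AB: "split A B" "card A + card B = k + 2" "2 \<le> card A" "2 \<le> card B"
    and edges: "\<And>A' B'. A' \<subseteq> A \<Longrightarrow> B' \<subseteq> B \<Longrightarrow> card A' + card B' = k \<Longrightarrow>
      A' \<union> B' \<in> step_edges k {(2, k - 2), (3, k - 3)} G"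
  have F: "2 \<le> p \<and> 2 \<le> q" if "(p, q) \<in> {(2, k - 2), (3, k - 3)}" for p q :: nat using that k by auto
  have sp: "split A' B'" if "A' \<subseteq> A" "B' \<subseteq> B" "1 \<le> card A'" "1 \<le> card B'" for A' B'
    using that by (intro split_mono[OF AB(1)]) auto
  have bal: "rcomb A' \<and> lcomb B' \<and> (card A', card B') \<in> {(2, k - 2), (3, k - 3)}"
    if "A' \<subseteq> A" "B' \<subseteq> B" "card A' + card B' = k" "2 \<le> card A'" "2 \<le> card B'" for A' B'
    using that sp[of A' B'] by (intro step_edge_balanced[OF edges]) auto
  have ex: "\<exists>Y\<subseteq>X. card Y = n" if "n \<le> card X" for X :: "nat set" and n
    using obtain_subset_with_card_n[OF that] by metis
  consider "card B \<le> 3" | "card A \<le> 3" | "4 \<le> card A" "4 \<le> card B" by linarith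
  then show False
  proof cases
    case 1
    obtain A1 where A1: "A1 \<subseteq> A" "card A1 = k - 1"
    proof -
      have "k - 1 \<le> card A" using 1 AB(2) by linarith
      then show ?thesis using ex that by metis
    qed
    obtain A2 where A2: "A2 \<subseteq> A1" "card A2 = k - 2"
      using ex[of "k - 2" A1] A1 diff_le_mono2[of 1 2 k] by auto
    obtain B1 where B1: "B1 \<subseteq> B" "card B1 = 1" using ex[of 1 B] AB by auto
    obtain B2 where B2: "B2 \<subseteq> B" "card B2 = 2" using ex[of 2 B] AB by auto
    have "lcomb (A1 \<union> B1)"
      using step_edge_unbalanced(2)[OF edges[OF A1(1) B1(1)] sp[OF A1(1) B1(1)] F] A1 B1 k by auto
    then have "lcomb A2" using A2 by (auto intro: lcomb_mono)
    moreover have "rcomb A2" using bal[of A2 B2] A1 A2 B2 k by auto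
    ultimately show False using rcomb_lcomb_card[of A2] A2 k by auto
  next
    case 2
    obtain B1 where B1: "B1 \<subseteq> B" "card B1 = k - 1"
    proof -
      have "k - 1 \<le> card B" using 2 AB(2) by linarith
      then show ?thesis using ex that by metis
    qed
    obtain B2 where B2: "B2 \<subseteq> B1" "card B2 = k - 2"
      using ex[of "k - 2" B1] B1 diff_le_mono2[of 1 2 k] by auto
    obtain A1 where A1: "A1 \<subseteq> A" "card A1 = 1" using ex[of 1 A] AB by auto
    obtain A2 where A2: "A2 \<subseteq> A" "card A2 = 2" using ex[of 2 A] AB by auto
    have "rcomb (A1 \<union> B1)"
      using step_edge_unbalanced(1)[OF edges[OF A1(1) B1(1)] sp[OF A1(1) B1(1)] F] A1 B1 k by auto
    then have "rcomb B2" using B2 by (auto intro: rcomb_mono)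
    moreover have "lcomb B2" using bal[of A2 B2] B1 A2 B2 k by auto
    ultimately show False using rcomb_lcomb_card[of B2] B2 k by auto
  next
    case 3
    obtain B2 where B2: "B2 \<subseteq> B" "card B2 = card B - 2"
      using ex[of "card B - 2" B] by auto
    moreover have "2 \<le> card B - 2" using 3 by linarith
    ultimately show False using bal[of A B2] 3 AB by auto
  qed
next
  fix W :: "nat set" and G assume W: "finite W" "(4 * s) ^ k \<le> card W" "\<not> (\<exists>S\<subseteq>W. comb S \<and> card S = Suc s)"
  let ?F = "{(2, k - 2), (3, k - 3)}"
  have "\<exists>A B. A \<union> B \<subseteq> W \<and> split A B \<and> rcomb A \<and> lcomb B \<and> card A = 3 \<and> card B = k - 2"
  proof (rule ccontr)
    assume "\<not> ?thesis"
    then have "card W \<le> (Suc s + Suc s) * Suc s ^ (k - 2)"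
      using W k unfolding comb_def by (intro card_le_without_balanced_pattern) auto
    also have "\<dots> \<le> (4 * s) * (2 * s) ^ (k - 2)"
      using \<open>1 \<le> s\<close> by (intro mult_le_mono power_mono) auto
    also have "\<dots> \<le> (4 * s) * (4 * s) ^ (k - 2)" by (intro mult_le_mono power_mono) auto
    also have "\<dots> = (4 * s) ^ (k - 1)" using k by (cases k) (auto simp: power_eq_if)
    also have "\<dots> < (4 * s) ^ k" using \<open>1 \<le> s\<close> k by (intro power_strict_increasing) auto
    finally show False using W by simp
  qed
  then obtain A B where AB: "A \<union> B \<subseteq> W" "split A B" "rcomb A" "lcomb B" "card A = 3" "card B = k - 2"
    by blast
  have fin: "finite A" "finite B" using AB W finite_subset by auto
  have dis: "A \<inter> B = {}" using split_disjoint[OF AB(2)] .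
  have "A \<union> B \<in> nsets W (k + 1)"
    using AB fin dis k by (auto simp: nsets_def card_Un_disjoint)
  moreover have "nsets (A \<union> B) k \<subseteq> step_edges k ?F G"
  proof
    fix e assume "e \<in> nsets (A \<union> B) k"
    then have e: "e \<subseteq> A \<union> B" "card e = k" "finite e" by (auto simp: nsets_def)
    define A' B' where "A' = e \<inter> A" and "B' = e \<inter> B"
    have e_eq: "e = A' \<union> B'" using e by (auto simp: A'_def B'_def)
    have c: "card A' + card B' = k"
      using e(2,3) dis unfolding e_eq by (subst (asm) card_Un_disjoint) (auto simp: A'_def B'_def)
    have "card A' \<le> 3" "card B' \<le> k - 2"
      using AB fin by (metis A'_def B'_def Int_lower2 card_mono)+
    then have cF: "(card A', card B') \<in> ?F" using c k by auto
    then have "A' \<noteq> {}" "B' \<noteq> {}" using k by auto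
    then have "split A' B'" by (intro split_mono[OF AB(2)]) (auto simp: A'_def B'_def)
    moreover have "rcomb A'" "lcomb B'"
      using AB rcomb_mono lcomb_mono by (metis A'_def B'_def Int_lower2)+
    ultimately show "e \<in> step_edges k ?F G" unfolding step_edges_def using e(2) e_eq cF by blast
  qed
  ultimately show "\<not> complete_free k (k + 1) W (step_edges k ?F G)"
    unfolding complete_free_def by blast
qed

section \<open>Towers and iterated logarithms\<close>

text \<open>
  The exponent is decreased by one because the tree with \<open>2 ^ N\<close> leaves has the \<open>N + 1\<close> levels
  \<open>0, \<dots>, N\<close>.
\<close>

fun tower :: "nat \<Rightarrow> nat \<Rightarrow> nat" where
  "tower 0 m = m"
| "tower (Suc j) m = 2 ^ (tower j m - 1)"

lemma tower_Suc': "tower (Suc j) m = tower j (2 ^ (m - 1))"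
  by (induction j) simp_all

lemma iter_log_Suc: "iter_log (Suc j) x = ln (iter_log j x)"
  by (simp add: iter_log_def)

lemma filterlim_iter_log: "filterlim (\<lambda>n. iter_log j (real n)) at_top sequentially"
proof (induction j)
  case 0
  then show ?case by (simp add: iter_log_def filterlim_real_sequentially)
next
  case (Suc j)
  then show ?case unfolding iter_log_Suc by (rule filterlim_compose[OF ln_at_top])
qed

lemma exp_half_le_two_powr:
  fixes u :: real
  assumes "0 \<le> u"
  shows "exp (u / 2) \<le> 2 powr u"
proof -
  have "exp (1 / 2 :: real) ^ 2 = exp 1" by (simp flip: exp_of_nat_mult)
  also have "\<dots> \<le> 2 ^ 2" using exp_le by simp
  finally have "exp (1 / 2 :: real) \<le> 2" by (rule power2_le_imp_le) simp
  then have "1 / 2 \<le> ln (2 :: real)" by (subst ln_ge_iff) auto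
  then have "u * (1 / 2) \<le> u * ln 2" using assms by (rule mult_left_mono)
  then show ?thesis by (simp add: powr_def)
qed

text \<open>
  The factor 3 absorbs both the change from base \<open>e\<close> to base \<open>2\<close> and the decrement in the tower.
\<close>

lemma eventually_le_tower:
  "\<forall>\<^sub>F n in sequentially. \<forall>m. 3 * iter_log j (real n) \<le> real m \<longrightarrow> n \<le> tower j m"
proof (induction j)
  case 0
  have "n \<le> m" if "3 * real n \<le> real m" for n m
  proof -
    have "real n \<le> real m" using that by simp
    then show ?thesis by simp
  qed
  then show ?case by (intro always_eventually) (simp add: iter_log_def)
next
  case (Suc j)
  have "\<forall>\<^sub>F z::real in at_top. 3 * exp z \<le> exp ((3 * z - 1) / 2)" by real_asymp
  then have "\<forall>\<^sub>F z::real in at_top. 3 * exp z \<le> 2 powr (3 * z - 1)"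
    using eventually_ge_at_top[of 1]
    by eventually_elim (rule order_trans[OF _ exp_half_le_two_powr], auto)
  then have exp_le: "\<forall>\<^sub>F n in sequentially. 3 * exp (iter_log (Suc j) (real n)) \<le> 2 powr (3 * iter_log (Suc j) (real n) - 1)"
    by (rule eventually_compose_filterlim[OF _ filterlim_iter_log])
  have pos: "\<forall>\<^sub>F n in sequentially. iter_log j (real n) > 0" "\<forall>\<^sub>F n in sequentially. iter_log (Suc j) (real n) > 0"
    using filterlim_iter_log by (auto simp: filterlim_at_top_dense)
  show ?case
    using Suc exp_le pos
  proof eventually_elim
    case (elim n)
    show ?case
    proof (intro allI impI)
      fix m assume m: "3 * iter_log (Suc j) (real n) \<le> real m"
      then have "m \<ge> 1" using elim(4) by (cases m) auto
      have "3 * iter_log j (real n) = 3 * exp (iter_log (Suc j) (real n))"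
        using elim(3) by (simp add: iter_log_Suc)
      also have "\<dots> \<le> 2 powr (3 * iter_log (Suc j) (real n) - 1)" by (rule elim(2))
      also have "\<dots> \<le> 2 powr real (m - 1)" using m \<open>m \<ge> 1\<close> by (intro powr_mono) auto
      also have "\<dots> = real (2 ^ (m - 1))" by (simp add: powr_realpow)
      finally show "n \<le> tower (Suc j) m" unfolding tower_Suc' using elim(1) by blast
    qed
  qed
qed

text \<open>
  With \<open>x = 10 ^ 6 * L / ln L\<close> and \<open>d\<close> the ceiling of \<open>log 10 x\<close>, the product \<open>d * 10 ^ d\<close> is at least
  \<open>x * log 10 x\<close>, a multiple of \<open>L\<close> that outweighs the denominator 10000, while \<open>10 ^ d\<close>
  exceeds \<open>x\<close> at most tenfold.
\<close>

lemma parameter_choice: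
  "\<forall>\<^sub>F L::real in at_top. \<exists>d\<ge>d0. 3 * exp L \<le> real (2 ^ (d * 10 ^ d div 10000)) \<and> 10 ^ d \<le> 10 ^ 7 * (L / ln L)"
proof -
  define x where "x = (\<lambda>L::real. 10 ^ 6 * L / ln L)"
  have "\<forall>\<^sub>F L in at_top. x L \<ge> 1" unfolding x_def by real_asymp
  moreover have "\<forall>\<^sub>F L in at_top. log 10 (x L) \<ge> real d0"
  proof -
    have "filterlim x at_top at_top" unfolding x_def by real_asymp
    then have "\<forall>\<^sub>F L in at_top. x L \<ge> 10 ^ d0" by (simp add: filterlim_at_top)
    then show ?thesis
    proof eventually_elim
      case (elim L)
      have "real d0 = log 10 (10 ^ d0)" by simp
      also have "\<dots> \<le> log 10 (x L)"
      proof (subst log_le_cancel_iff)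
        show "0 < x L" by (rule less_le_trans[OF _ elim]) simp
      qed (use elim in auto)
      finally show ?case .
    qed
  qed
  moreover have "\<forall>\<^sub>F L in at_top. 3 * exp L \<le> exp ((L * 4 - 1) / 2 :: real)"
    by real_asymp
  moreover have "\<forall>\<^sub>F L in at_top. ln L / 2 \<le> ln (x L)" unfolding x_def by real_asymp
  moreover have "\<forall>\<^sub>F L in at_top. ln L > (0::real)" "\<forall>\<^sub>F L in at_top. L > (0::real)" by real_asymp+
  ultimately show ?thesis
  proof eventually_elim
    case (elim L)
    define d where "d = nat \<lceil>log 10 (x L)\<rceil>"
    have "log 10 (x L) \<ge> 0" using elim(1) by simp
    then have d: "log 10 (x L) \<le> real d" "real d \<le> log 10 (x L) + 1" unfolding d_def by linarith+
    have "d \<ge> d0" using d(1) elim(2) by linarith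
    have "x L = 10 powr log 10 (x L)" using elim(1) by simp
    also have "\<dots> \<le> 10 powr d" using d by (intro powr_mono) auto
    also have "\<dots> = 10 ^ d" by (simp add: powr_realpow)
    finally have x_le: "x L \<le> 10 ^ d" .
    have "(10::real) ^ d = 10 powr d" by (simp add: powr_realpow)
    also have "\<dots> \<le> 10 powr (log 10 (x L) + 1)" using d by (intro powr_mono) auto
    also have "\<dots> = 10 * x L" using elim(1) by (simp add: powr_add)
    finally have upper: "10 ^ d \<le> 10 ^ 7 * (L / ln L)" by (simp add: x_def)
    have "ln L / 8 \<le> real d"
    proof -
      have "ln (10::real) \<le> ln (2 ^ 4)" by simp
      also have "\<dots> = 4 * ln 2" by (subst ln_realpow) auto
      also have "\<dots> \<le> 4" using ln_le_minus_one[of "2::real"] by simp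
      finally have ln10: "ln (10::real) \<le> 4" .
      have "ln L / 8 \<le> ln (x L) / 4" using elim(4) by simp
      also have "\<dots> \<le> ln (x L) / ln 10" using elim(1) ln10 by (intro divide_left_mono) auto
      also have "\<dots> = log 10 (x L)" by (simp add: log_def)
      finally show ?thesis using d by simp
    qed
    \<comment> \<open>The right-hand side is \<open>100 / 8 * L\<close>.\<close>
have "L * 4 \<le> (ln L / 8) * x L / 10000" using elim(5,6) by (simp add: x_def)
    also have "\<dots> \<le> real d * 10 ^ d / 10000"
      using x_le \<open>ln L / 8 \<le> real d\<close> elim(1,5) by (intro divide_right_mono mult_mono) auto
    also have "\<dots> \<le> real (d * 10 ^ d div 10000) + 1"
    proof -
      have "d * 10 ^ d \<le> 10000 * (d * 10 ^ d div 10000) + 10000"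
        using mod_less_divisor[of 10000 "d * 10 ^ d"] div_mult_mod_eq[of "d * 10 ^ d" 10000] by linarith
      then have "real (d * 10 ^ d) \<le> real (10000 * (d * 10 ^ d div 10000) + 10000)"
        by (simp only: of_nat_le_iff)
      then show ?thesis by simp
    qed
    finally have "L * 4 - 1 \<le> real (d * 10 ^ d div 10000)" by simp
    moreover have "exp ((L * 4 - 1) / 2) \<le> 2 powr (max 0 (L * 4 - 1))"
    proof (cases "L * 4 - 1 \<ge> 0")
      case True then show ?thesis using exp_half_le_two_powr[OF True] by simp
    qed simp
    ultimately have "exp ((L * 4 - 1) / 2) \<le> 2 powr real (d * 10 ^ d div 10000)"
      by (elim order_trans) (intro powr_mono; simp)
    also have "\<dots> = real (2 ^ (d * 10 ^ d div 10000))" by (simp add: powr_realpow)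
    finally show ?case using elim(3) upper \<open>d \<ge> d0\<close> by (intro exI[of _ d]) auto
  qed
qed

section \<open>From hypergraphs to the Erdos-Rogers function\<close>

definition far_triples :: "nat \<Rightarrow> (nat \<times> nat \<Rightarrow> nat list) \<Rightarrow> nat set set" where
  "far_triples N f = {{a, b, c} |a b c. a < b \<and> b < c \<and> c < N \<and> far (f (a, b)) (f (a, c))}"

lemma far_triplesD:
  assumes "{a, b, c} \<in> far_triples N f" "a < b" "b < c"
  shows "far (f (a, b)) (f (a, c))"
proof -
  obtain a' b' c' where eq: "{a, b, c} = {a', b', c'}" and "a' < b'" "b' < c'"
    and far: "far (f (a', b')) (f (a', c'))"
    using assms(1) unfolding far_triples_def by auto
  then have "[a, b, c] = [a', b', c']"
    using assms(2,3) by (intro sorted_distinct_set_unique) auto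
  then show ?thesis using far by simp
qed

text \<open>
  The smallest vertex of a clique on five vertices would carry four pairwise far words; cliques
  on four vertices are the far quadruples.
\<close>

lemma er_witness_3:
  "\<exists>d0. \<forall>d\<ge>d0. er_witness 3 (2 ^ (d * 10 ^ d div 10000)) (7 * 10 ^ d)"
proof -
  obtain d0 where "\<forall>d\<ge>d0. \<forall>t N. t = 10 ^ d \<longrightarrow> N = 2 ^ (d * t div 10000) \<longrightarrow>
    (\<exists>f\<in>colourings N d. \<forall>W\<subseteq>{..<N}. 7 * t \<le> card W \<longrightarrow>
      (\<exists>a\<in>W. \<exists>b\<in>W. \<exists>c\<in>W. \<exists>c'\<in>W. a < b \<and> b < c \<and> c < c' \<and> far_quad f a b c c'))"
    using exists_colouring_with_quads by (rule exE)
  then have d0: "\<exists>f\<in>colourings N d. \<forall>W\<subseteq>{..<N}. 7 * 10 ^ d \<le> card W \<longrightarrow>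
      (\<exists>a\<in>W. \<exists>b\<in>W. \<exists>c\<in>W. \<exists>c'\<in>W. a < b \<and> b < c \<and> c < c' \<and> far_quad f a b c c')"
    if "d \<ge> d0" "N = 2 ^ (d * 10 ^ d div 10000)" for d N
    using that by simp
  show ?thesis
  proof (intro exI[of _ d0] allI impI)
    fix d assume "d \<ge> d0"
    define N where "N = (2::nat) ^ (d * 10 ^ d div 10000)"
    obtain f where f: "f \<in> colourings N d"
      and quads: "\<And>W. W \<subseteq> {..<N} \<Longrightarrow> 7 * 10 ^ d \<le> card W \<Longrightarrow>
        (\<exists>a\<in>W. \<exists>b\<in>W. \<exists>c\<in>W. \<exists>c'\<in>W. a < b \<and> b < c \<and> c < c' \<and> far_quad f a b c c')"
      using d0[OF \<open>d \<ge> d0\<close> N_def] by auto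
    have "complete_free 3 (3 + 2) {..<N} (far_triples N f)"
      unfolding complete_free_def
    proof
      assume "\<exists>T\<in>nsets {..<N} (3 + 2). nsets T 3 \<subseteq> far_triples N f"
      then obtain T where T: "T \<subseteq> {..<N}" "finite T" "card T = 5" "nsets T 3 \<subseteq> far_triples N f"
        by (auto simp: nsets_def)
      obtain g where g: "g ` {..<5::nat} = T" "\<And>i j. i < j \<Longrightarrow> j < 5 \<Longrightarrow> g i < g j"
        using increasing_enumeration[OF T(2,3)] by metis
      have gT: "g i \<in> T" if "i < 5" for i using g(1) that by auto
      have far: "far (f (g 0, g i)) (f (g 0, g j))" if "0 < i" "i < j" "j < 5" for i j
      proof -
        have "g 0 < g i" "g i < g j" using g(2) that by auto
        moreover from this have "{g 0, g i, g j} \<in> nsets T 3"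
          using gT that by (auto simp: nsets_def card_insert_if)
        ultimately show ?thesis using T(4) by (intro far_triplesD) auto
      qed
      have "f (g 0, g i) \<in> words d" if "0 < i" "i < 5" for i
        using g(2)[OF that] gT[OF that(2)] T(1) by (intro PiE_mem[OF f]) (auto simp: upairs_def)
      then show False
        using not_four_far[of "f (g 0, g 1)" d "f (g 0, g 2)" "f (g 0, g 3)" "f (g 0, g 4)"]
          far[of 1 2] far[of 1 3] far[of 1 4] far[of 2 3] far[of 2 4] far[of 3 4] by simp
    qed
    moreover have "\<not> complete_free 3 (3 + 1) W (far_triples N f)"
      if W: "W \<subseteq> {..<N}" "7 * 10 ^ d \<le> card W" for W
    proof -
      obtain a b c c' where abc: "a \<in> W" "b \<in> W" "c \<in> W" "c' \<in> W" "a < b" "b < c" "c < c'"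
        and far: "far_quad f a b c c'"
        using quads[OF W] by auto
      let ?T = "{a, b, c, c'}"
      have "card ?T = 4" using abc by (simp add: card_insert_if)
      have "?T \<in> nsets W (3 + 1)" using abc by (simp add: nsets_def card_insert_if)
      moreover have "nsets ?T 3 \<subseteq> far_triples N f"
      proof
        fix e assume "e \<in> nsets ?T 3"
        then have e: "e \<subseteq> ?T" "card e = 3" "finite e" by (auto simp: nsets_def)
        then have "card (?T - e) = 1" using \<open>card ?T = 4\<close> by (simp add: card_Diff_subset)
        then obtain x where x: "?T - e = {x}" by (auto simp: card_1_singleton_iff)
        then have e_eq: "e = ?T - {x}" using e(1) by blast
        have "x \<in> ?T" using x by blast
        have tri: "{u, v, w} \<in> far_triples N f"
          if "u < v" "v < w" "w \<in> W" "far (f (u, v)) (f (u, w))" for u v w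
          using that W(1) unfolding far_triples_def by blast
        from \<open>x \<in> ?T\<close> consider "x = a" | "x = b" | "x = c" | "x = c'" by blast
        then show "e \<in> far_triples N f"
        proof cases
          case 1
          then have "e = {b, c, c'}" using e_eq abc by auto
          then show ?thesis using tri[of b c c'] abc far by (simp add: far_quad_def)
        next
          case 2
          then have "e = {a, c, c'}" using e_eq abc by auto
          then show ?thesis using tri[of a c c'] abc far by (simp add: far_quad_def)
        next
          case 3
          then have "e = {a, b, c'}" using e_eq abc by auto
          then show ?thesis using tri[of a b c'] abc far by (simp add: far_quad_def)
        next
          case 4
          then have "e = {a, b, c}" using e_eq abc by auto
          then show ?thesis using tri[of a b c] abc far by (simp add: far_quad_def)
        qed
      qed
      ultimately show ?thesis unfolding complete_free_def by blast
    qed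
    ultimately show "er_witness 3 (2 ^ (d * 10 ^ d div 10000)) (7 * 10 ^ d)"
      unfolding er_witness_def N_def[symmetric] by blast
  qed
qed

lemma er_witness_mono:
  assumes "er_witness k n s" "n' \<le> n" "s \<le> s'"
  shows "er_witness k n' s'"
proof -
  obtain E where E: "complete_free k (k + 2) {..<n} E"
      "\<And>W. W \<subseteq> {..<n} \<Longrightarrow> s \<le> card W \<Longrightarrow> \<not> complete_free k (k + 1) W E"
    using assms(1) unfolding er_witness_def by blast
  have sub: "{..<n'} \<subseteq> {..<n}" using assms(2) by auto
  have "complete_free k (k + 2) {..<n'} E"
    using E(1) nsets_mono[OF sub] unfolding complete_free_def by blast
  moreover have "\<not> complete_free k (k + 1) W E" if "W \<subseteq> {..<n'}" "s' \<le> card W" for W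
    using E(2)[OF order_trans[OF that(1) sub]] that(2) assms(3) by simp
  ultimately show ?thesis unfolding er_witness_def by blast
qed

lemma er_witness_tower:
  assumes "4 \<le> k"
  shows "\<exists>c\<ge>1. \<exists>d0. \<forall>d\<ge>d0. er_witness k (tower (k - 3) (2 ^ (d * 10 ^ d div 10000))) (2 ^ (c * 10 ^ d))"
  using assms
proof (induction k rule: dec_induct)
  case base
  obtain d0 where d0: "\<And>d. d \<ge> d0 \<Longrightarrow> er_witness 3 (2 ^ (d * 10 ^ d div 10000)) (7 * 10 ^ d)"
    using er_witness_3 by blast
  have "er_witness 4 (tower (4 - 3) (2 ^ (d * 10 ^ d div 10000))) (2 ^ (17 * 10 ^ d))" if "d \<ge> d0" for d
  proof -
    define N where "N = (2::nat) ^ (d * 10 ^ d div 10000)"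
    have "Suc (N - 1) = N" by (simp add: N_def)
    then have "er_witness 4 (2 ^ (N - 1)) (Suc (2 ^ (2 * Suc (7 * 10 ^ d))))"
      using d0[OF that] by (intro step_up_from_3) (simp add: N_def)
    moreover have "Suc (2 ^ (2 * Suc (7 * 10 ^ d))) \<le> 2 ^ (17 * 10 ^ d)"
    proof -
      have "Suc (2 ^ (2 * Suc (7 * 10 ^ d))) \<le> 2 ^ Suc (2 * Suc (7 * 10 ^ d))" by simp
      also have "\<dots> \<le> 2 ^ (17 * 10 ^ d)"
      proof (intro power_increasing)
        have "(1::nat) \<le> 10 ^ d" by simp
        then show "Suc (2 * Suc (7 * 10 ^ d)) \<le> 17 * 10 ^ d" by simp
      qed simp
      finally show ?thesis .
    qed
    ultimately have "er_witness 4 (2 ^ (N - 1)) (2 ^ (17 * 10 ^ d))" by (auto intro: er_witness_mono)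
    then show ?thesis by (simp add: N_def)
  qed
  then show ?case by (intro exI[of _ 17]) auto
next
  case (step k)
  then obtain c d0 where c: "c \<ge> 1"
      "\<And>d. d \<ge> d0 \<Longrightarrow> er_witness k (tower (k - 3) (2 ^ (d * 10 ^ d div 10000))) (2 ^ (c * 10 ^ d))"
    by blast
  have "er_witness (Suc k) (tower (Suc k - 3) (2 ^ (d * 10 ^ d div 10000))) (2 ^ ((2 + c) * Suc k * 10 ^ d))"
    if "d \<ge> d0" for d
  proof -
    define N where "N = tower (k - 3) (2 ^ (d * 10 ^ d div 10000))"
    have "N > 0" unfolding N_def by (cases "k - 3") auto
    then have w: "er_witness (Suc k) (2 ^ (N - 1)) ((4 * 2 ^ (c * 10 ^ d)) ^ Suc k)"
      using c(2)[OF that] step(1) by (intro step_up_polynomial) (auto simp: N_def)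
    have N_eq: "2 ^ (N - 1) = tower (Suc k - 3) (2 ^ (d * 10 ^ d div 10000))"
    proof -
      have "Suc k - 3 = Suc (k - 3)" using step(1) by simp
      then show ?thesis by (simp only: tower.simps N_def)
    qed
    have "(4 * 2 ^ (c * 10 ^ d)) ^ Suc k \<le> (2::nat) ^ ((2 + c) * Suc k * 10 ^ d)"
    proof -
      have "(4 * 2 ^ (c * 10 ^ d)) ^ Suc k = (2::nat) ^ ((2 + c * 10 ^ d) * Suc k)"
        by (simp only: power_mult power_add) simp
      also have "\<dots> \<le> 2 ^ ((2 + c) * Suc k * 10 ^ d)"
      proof (intro power_increasing)
        have "(1::nat) \<le> 10 ^ d" by simp
        then have "2 + c * 10 ^ d \<le> (2 + c) * 10 ^ d" unfolding add_mult_distrib by linarith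
        then have "(2 + c * 10 ^ d) * Suc k \<le> (2 + c) * 10 ^ d * Suc k" by (rule mult_le_mono1)
        then show "(2 + c * 10 ^ d) * Suc k \<le> (2 + c) * Suc k * 10 ^ d" by (simp only: mult_ac)
      qed simp
      finally show ?thesis .
    qed
    then show ?thesis using er_witness_mono[OF w order_refl] unfolding N_eq by blast
  qed
  then show ?case by (intro exI[of _ "(2 + c) * Suc k"]) auto
qed

lemma erdos_rogers_less:
  assumes "er_witness k n s" "0 < k"
  shows "erdos_rogers k (k + 1) (k + 2) n < s"
proof (rule ccontr)
  assume "\<not> ?thesis"
  then have s: "s \<le> erdos_rogers k (k + 1) (k + 2) n" by simp
  obtain E where E: "complete_free k (k + 2) {..<n} E"
      "\<And>W. W \<subseteq> {..<n} \<Longrightarrow> s \<le> card W \<Longrightarrow> \<not> complete_free k (k + 1) W E"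
    using assms(1) unfolding er_witness_def by blast
  define E' where "E' = E \<inter> nsets {..<n} k"
  have "uniform_hypergraph k {..<n} E'" "card {..<n} = n" "complete_free k (k + 2) {..<n} E'"
    using E(1) by (auto simp: uniform_hypergraph_def E'_def complete_free_def)
  moreover have "erdos_rogers_bound TYPE(nat) k (k + 1) (k + 2) n (erdos_rogers k (k + 1) (k + 2) n)"
    using assms(2) by (intro erdos_rogers_greatest) auto
  ultimately obtain W where W: "W \<subseteq> {..<n}" "card W = erdos_rogers k (k + 1) (k + 2) n"
      "complete_free k (k + 1) W (induced_edges E' W)"
    unfolding erdos_rogers_bound_def by blast
  obtain T where T: "T \<in> nsets W (k + 1)" "nsets T k \<subseteq> E"
    using E(2)[OF W(1)] s W(2) unfolding complete_free_def by auto
  have "e \<in> induced_edges E' W" if "e \<in> nsets T k" for e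
    using that T W(1) by (auto simp: induced_edges_def E'_def nsets_def)
  then show False using W(3) T(1) unfolding complete_free_def by blast
qed

text \<open>
  A single vertex spans no clique. The bound is needed for the second part of the theorem, where
  the logarithm of the Erdos-Rogers function is taken.
\<close>

lemma erdos_rogers_pos:
  assumes "0 < k" "0 < n"
  shows "1 \<le> erdos_rogers k (k + 1) (k + 2) n"
proof (rule erdos_rogers_greatest(2))
  show "erdos_rogers_bound TYPE(nat) k (k + 1) (k + 2) n 1"
    unfolding erdos_rogers_bound_def
  proof (intro allI impI)
    fix V :: "nat set" and E assume "uniform_hypergraph k V E \<and> card V = n \<and> complete_free k (k + 2) V E"
    then obtain v where "v \<in> V" using assms(2) by fastforce
    moreover have "nsets {v} (k + 1) = {}"
    proof -
      have "e \<notin> nsets {v} (k + 1)" for e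
      proof
        assume "e \<in> nsets {v} (k + 1)"
        then have "e \<subseteq> {v}" "card e = k + 1" by (simp_all add: nsets_def)
        then show False using card_mono[of "{v}" e] assms(1) by simp
      qed
      then show ?thesis by blast
    qed
    ultimately show "\<exists>W\<subseteq>V. card W = 1 \<and> complete_free k (k + 1) W (induced_edges E W)"
      by (intro exI[of _ "{v}"]) (simp add: complete_free_def)
  qed
qed (use assms in auto)

theorem corollary1p6:
  fixes k :: nat
  assumes "k \<ge> 5"
  shows "(\<exists>C::real. C > 0 \<and>
            (\<forall>\<^sub>F n::nat in sequentially.
               real (erdos_rogers k (k + 1) (k + 2) n)
                 \<le> exp (C * (iter_log (k - 2) (real n) / iter_log (k - 1) (real n)))))
       \<and> (\<exists>\<epsilon>::nat \<Rightarrow> real. \<epsilon> \<in> o(\<lambda>_. 1) \<and>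
            (\<forall>\<^sub>F n::nat in sequentially.
               real (erdos_rogers k (k + 1) (k + 2) n)
                 = iter_log (k - 3) (real n) powr \<epsilon> n))"
proof -
  define er where "er n = erdos_rogers k (k + 1) (k + 2) n" for n
  define L where "L n = iter_log (k - 2) (real n)" for n
  have L_eq: "L n = ln (iter_log (k - 3) (real n))" "iter_log (k - 1) (real n) = ln (L n)" for n
  proof -
    have "k - 2 = Suc (k - 3)" "k - 1 = Suc (k - 2)" using assms by auto
    then show "L n = ln (iter_log (k - 3) (real n))" "iter_log (k - 1) (real n) = ln (L n)"
      unfolding L_def by (simp_all only: iter_log_Suc)
  qed
  have L_top: "filterlim L at_top sequentially"
    unfolding L_def by (rule filterlim_iter_log)
  have lnL_top: "filterlim (\<lambda>n. ln (L n)) at_top sequentially"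
    using L_top by (rule filterlim_compose[OF ln_at_top])
  have y_pos: "\<forall>\<^sub>F n in sequentially. iter_log (k - 3) (real n) > 1"
    using filterlim_iter_log by (auto simp: filterlim_at_top_dense)
  obtain c d0 where c: "c \<ge> 1"
      "\<And>d. d \<ge> d0 \<Longrightarrow> er_witness k (tower (k - 3) (2 ^ (d * 10 ^ d div 10000))) (2 ^ (c * 10 ^ d))"
    using er_witness_tower[of k] assms by auto
  define C where "C = real c * 10 ^ 7"
  have "C > 0" using c(1) by (simp add: C_def)
  have upper: "\<forall>\<^sub>F n in sequentially. real (er n) \<le> exp (C * (L n / ln (L n)))"
    using eventually_compose_filterlim[OF parameter_choice[of d0] L_top]
      eventually_le_tower[of "k - 3"] y_pos
  proof eventually_elim
    case (elim n)
    then obtain d where d: "d \<ge> d0" "3 * exp (L n) \<le> real (2 ^ (d * 10 ^ d div 10000))"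
        "10 ^ d \<le> 10 ^ 7 * (L n / ln (L n))"
      by blast
    have "3 * iter_log (k - 3) (real n) \<le> real (2 ^ (d * 10 ^ d div 10000))"
      using d(2) elim(3) by (simp add: L_eq(1))
    then have "n \<le> tower (k - 3) (2 ^ (d * 10 ^ d div 10000))" using elim(2) by blast
    then have "er_witness k n (2 ^ (c * 10 ^ d))" using c(2)[OF d(1)] er_witness_mono by blast
    then have "er n < 2 ^ (c * 10 ^ d)"
      unfolding er_def using assms by (intro erdos_rogers_less) auto
    then have "real (er n) \<le> real (2 ^ (c * 10 ^ d))" by (simp only: of_nat_le_iff)
    also have "\<dots> = 2 ^ (c * 10 ^ d)" by simp
    also have "\<dots> \<le> exp 1 ^ (c * 10 ^ d)" using exp_ge_add_one_self[of 1] by (intro power_mono) auto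
    also have "\<dots> = exp (real c * 10 ^ d)" by (simp flip: exp_of_nat_mult)
    also have "\<dots> \<le> exp (C * (L n / ln (L n)))"
      using mult_left_mono[OF d(3), of "real c"] by (simp add: C_def)
    finally show ?case .
  qed
  define \<epsilon> where "\<epsilon> n = ln (real (er n)) / L n" for n
  have er_ge: "\<forall>\<^sub>F n in sequentially. er n \<ge> 1"
    using eventually_gt_at_top[of 0] unfolding er_def
    by eventually_elim (use assms in \<open>intro erdos_rogers_pos; simp\<close>)
  have L_pos: "\<forall>\<^sub>F n in sequentially. L n > 0" "\<forall>\<^sub>F n in sequentially. ln (L n) > 0"
    using L_top lnL_top by (auto simp: filterlim_at_top_dense)
  have "(\<epsilon> \<longlongrightarrow> 0) sequentially"
  proof (rule tendsto_sandwich)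
    show "\<forall>\<^sub>F n in sequentially. 0 \<le> \<epsilon> n"
      using er_ge L_pos(1) by eventually_elim (simp add: \<epsilon>_def)
    show "\<forall>\<^sub>F n in sequentially. \<epsilon> n \<le> C / ln (L n)"
      using er_ge L_pos upper
    proof eventually_elim
      case (elim n)
      have "ln (real (er n)) \<le> ln (exp (C * (L n / ln (L n))))"
        using elim by (subst ln_le_cancel_iff) auto
      then have "ln (real (er n)) \<le> C / ln (L n) * L n" by (simp add: field_simps)
      then show ?case using elim(2) unfolding \<epsilon>_def by (simp add: pos_divide_le_eq)
    qed
    show "(\<lambda>n. C / ln (L n)) \<longlonglongrightarrow> 0"
      by (rule real_tendsto_divide_at_top[OF tendsto_const lnL_top])
  qed simp
  then have "\<epsilon> \<in> o(\<lambda>_. 1)" by (intro smalloI_tendsto) auto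
  moreover have "\<forall>\<^sub>F n in sequentially. real (er n) = iter_log (k - 3) (real n) powr \<epsilon> n"
    using er_ge L_pos(1) y_pos
  proof eventually_elim
    case (elim n)
    then have "iter_log (k - 3) (real n) powr \<epsilon> n = exp (\<epsilon> n * L n)"
      by (simp add: powr_def L_eq(1))
    also have "\<epsilon> n * L n = ln (real (er n))" using elim by (simp add: \<epsilon>_def)
    finally show ?case using elim by simp
  qed
  ultimately have "\<exists>\<epsilon>\<in>o(\<lambda>_. 1). \<forall>\<^sub>F n in sequentially. real (er n) = iter_log (k - 3) (real n) powr \<epsilon> n"
    by blast
  moreover have "\<exists>C>0. \<forall>\<^sub>F n in sequentially. real (er n) \<le> exp (C * (L n / ln (L n)))"
    using upper \<open>C > 0\<close> by blast
  ultimately show ?thesis by (simp only: er_def L_eq(2) L_def Bex_def)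
qed

end
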